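(* Let $E$ be a complex Banach lattice and let $(e^{tA})_{t\ge0}$ be a real and individually eventually positive $C_0$-semigroup on $E$ such that for every $0\lneq f\in E$ there exists $t_f\ge0$ such that $e^{t_fA}f$ is a quasi-interior point of $E_+$. If $(e^{tA})_{t\ge0}$ has relatively compact orbits, then exactly one of the following holds: (i) The semigroup $(e^{tA})_{t\ge0}$ converges strongly to $0$ as $t\to\infty$. (ii) The semigroup $(e^{tA})_{t\ge0}$ converges strongly as $t\to\infty$ to the rank-one projection $u\otimes\varphi$ for a quasi-interior point $u$ of $E_+$ and a strictly positive functional $\varphi\in E'$ such that $u\in\ker A$ and $\varphi\in\ker A'$.
   Context: $E_+$ is the positive cone; $0\lneq f$ means $f\ge0$ and $f\neq0$. A bounded operator on a complex Banach lattice is real if it maps the real part $E_{\mathbb R}$ into itself; a semigroup is real if each $e^{tA}$ is real. The semigroup is individually eventually positive if for each $0\le f\in E$ there is $t_0\ge0$ with $e^{tA}f\ge0$ for all $t\ge t_0$. It has relatively compact orbits if $\{e^{tA}f:t\ge0\}$ is relatively (norm) compact for every $f\in E$. An element $u\in E_+$ is a quasi-interior point of $E_+$ if the principal ideal $E_u=\{f\in E:|f|\le cu\text{ for some }c>0\}$ is dense in $E$. A positive functional $\varphi\in E'$ is strictly positive if $\langle\varphi,f\rangle>0$ for all $0\lneq f\in E$. $u\otimes\varphi$ is the operator $f\mapsto\langle\varphi,f\rangle u$. *)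

theory Defs
  imports "HOL-Analysis.Analysis" "HOL-Library.Lattice_Algebras"
begin

section \<open>Real Banach lattices\<close>

class banach_lattice = banach + lattice_ab_group_add_abs + ordered_real_vector +
  assumes norm_mono_abs: "\<bar>x\<bar> \<le> \<bar>y\<bar> \<Longrightarrow> norm x \<le> norm y"

lemma norm_abs_lattice: "norm \<bar>x\<bar> = norm (x :: 'a::banach_lattice)"
  by (intro order.antisym norm_mono_abs) simp_all

lemma banach_lattice_norm_mono:
  fixes x y :: "'a::banach_lattice"
  assumes "0 \<le> x" "x \<le> y"
  shows "norm x \<le> norm y"
  using assms by (intro norm_mono_abs) (simp add: order_trans[OF assms])

lemma banach_lattice_norm_le:
  fixes x y :: "'a::banach_lattice"
  assumes "\<bar>x\<bar> \<le> y"
  shows "norm x \<le> norm y"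
  using banach_lattice_norm_mono[of "\<bar>x\<bar>" y] assms by (simp add: norm_abs_lattice)

lemma abs_scaleR_lattice:
  fixes x :: "'a::banach_lattice"
  shows "\<bar>a *\<^sub>R x\<bar> = \<bar>a\<bar> *\<^sub>R \<bar>x\<bar>"
proof -
  have pos: "\<bar>a *\<^sub>R x\<bar> \<le> a *\<^sub>R \<bar>x\<bar>" if "0 \<le> a" for a and x :: 'a
  proof (rule abs_leI)
    show "a *\<^sub>R x \<le> a *\<^sub>R \<bar>x\<bar>"
      using that by (intro scaleR_left_mono abs_ge_self)
    have "a *\<^sub>R (- x) \<le> a *\<^sub>R \<bar>x\<bar>"
      using that by (intro scaleR_left_mono) (auto simp: abs_ge_minus_self)
    then show "- (a *\<^sub>R x) \<le> a *\<^sub>R \<bar>x\<bar>" by simp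
  qed
  have eq: "\<bar>a *\<^sub>R x\<bar> = a *\<^sub>R \<bar>x\<bar>" if a: "0 < a" for a and x :: 'a
  proof (rule order.antisym)
    show "\<bar>a *\<^sub>R x\<bar> \<le> a *\<^sub>R \<bar>x\<bar>" using pos a by simp
    have "\<bar>inverse a *\<^sub>R a *\<^sub>R x\<bar> \<le> inverse a *\<^sub>R \<bar>a *\<^sub>R x\<bar>"
      using a by (intro pos) simp
    then have "\<bar>x\<bar> \<le> inverse a *\<^sub>R \<bar>a *\<^sub>R x\<bar>" using a by simp
    from scaleR_left_mono[OF this, of a]
    show "a *\<^sub>R \<bar>x\<bar> \<le> \<bar>a *\<^sub>R x\<bar>" using a by simp
  qed
  consider "a = 0" | "a > 0" | "a < 0" by linarith
  then show ?thesis
  proof cases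
    case 3
    then have "\<bar>(- a) *\<^sub>R x\<bar> = (- a) *\<^sub>R \<bar>x\<bar>" by (intro eq) simp
    then show ?thesis using 3 by simp
  qed (auto simp: eq)
qed

lemma banach_lattice_nonneg_limit:
  fixes X :: "nat \<Rightarrow> 'a::banach_lattice"
  assumes lim: "X \<longlonglongrightarrow> x" and nonneg: "\<And>n. 0 \<le> X n"
  shows "0 \<le> x"
proof -
  have "norm (sup (- x) 0) \<le> norm (X n - x)" for n
  proof -
    have "X n - x \<le> \<bar>X n - x\<bar>" by (rule abs_ge_self)
    then have "- x \<le> \<bar>X n - x\<bar>"
      using nonneg[of n] by (metis add_increasing diff_conv_add_uminus order_trans le_add_same_cancel2)
    then have "sup (- x) 0 \<le> \<bar>X n - x\<bar>" by simp
    then have "norm (sup (- x) 0) \<le> norm \<bar>X n - x\<bar>"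
      by (intro banach_lattice_norm_mono) auto
    then show ?thesis by (simp add: norm_abs_lattice)
  qed
  moreover have "(\<lambda>n. norm (X n - x)) \<longlonglongrightarrow> 0"
    using lim by (simp add: LIM_zero tendsto_norm_zero)
  ultimately have "norm (sup (- x) 0) \<le> 0"
    by (meson LIMSEQ_le_const)
  then have "sup (- x) 0 = 0" by simp
  then have "- x \<le> 0" by (metis sup_ge1)
  then show ?thesis by simp
qed

lemma banach_lattice_le_limit:
  fixes X Y :: "nat \<Rightarrow> 'a::banach_lattice"
  assumes "X \<longlonglongrightarrow> x" "Y \<longlonglongrightarrow> y" "\<And>n. X n \<le> Y n"
  shows "x \<le> y"
  using banach_lattice_nonneg_limit[OF tendsto_diff[OF assms(2,1)]] assms(3) by simp

section \<open>The modulus\<close>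

definition is_modulus :: "'a::banach_lattice \<Rightarrow> 'a \<Rightarrow> 'a \<Rightarrow> bool" where
  "is_modulus x y m \<longleftrightarrow>
     (\<forall>\<theta>. cos \<theta> *\<^sub>R x + sin \<theta> *\<^sub>R y \<le> m) \<and>
     (\<forall>b. (\<forall>\<theta>. cos \<theta> *\<^sub>R x + sin \<theta> *\<^sub>R y \<le> b) \<longrightarrow> m \<le> b)"

text \<open>The modulus of \<open>x + iy\<close>, i.e. the supremum over all real \<open>\<theta>\<close> of
  \<open>cos \<theta> x + sin \<theta> y\<close>; the lemma \<open>is_modulus\<close> below shows that it exists.\<close>

definition modulus :: "'a::banach_lattice \<Rightarrow> 'a \<Rightarrow> 'a" where
  "modulus x y = (THE m. is_modulus x y m)"

lemma is_modulus_unique: "is_modulus x y m \<Longrightarrow> is_modulus x y m' \<Longrightarrow> m = m'"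
  unfolding is_modulus_def by (meson order.antisym)

lemma finite_cis_net:
  assumes "e > 0"
  obtains F :: "real set" where "finite F" "F \<noteq> {}" "\<And>\<theta>. \<exists>\<eta>\<in>F. norm (cis \<theta> - cis \<eta>) < e"
proof -
  have cover: "sphere (0::complex) 1 \<subseteq> (\<Union>\<eta>\<in>UNIV. ball (cis \<eta>) e)"
  proof
    fix z :: complex assume "z \<in> sphere 0 1"
    then have "cis (Arg z) = z" by (cases "z = 0") (auto simp: cis_Arg sgn_div_norm)
    then have "z \<in> ball (cis (Arg z)) e" using assms by simp
    then show "z \<in> (\<Union>\<eta>\<in>UNIV. ball (cis \<eta>) e)" by blast
  qed
  obtain F where F: "finite F" "sphere (0::complex) 1 \<subseteq> (\<Union>\<eta>\<in>F. ball (cis \<eta>) e)"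
    using compactE_image[OF compact_sphere _ cover] by (metis open_ball)
  have *: "\<exists>\<eta>\<in>F. norm (cis \<theta> - cis \<eta>) < e" for \<theta>
  proof -
    have "cis \<theta> \<in> sphere 0 1" by simp
    then obtain \<eta> where "\<eta> \<in> F" "cis \<theta> \<in> ball (cis \<eta>) e" using F(2) by blast
    then show ?thesis by (auto simp: dist_norm norm_minus_commute)
  qed
  then have "F \<noteq> {}" by blast
  with F(1) * show ?thesis using that by blast
qed

lemma rotation_diff_le:
  fixes x y :: "'a::banach_lattice"
  shows "cos \<theta> *\<^sub>R x + sin \<theta> *\<^sub>R y
           \<le> cos \<eta> *\<^sub>R x + sin \<eta> *\<^sub>R y + norm (cis \<theta> - cis \<eta>) *\<^sub>R (\<bar>x\<bar> + \<bar>y\<bar>)"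
proof -
  let ?d = "norm (cis \<theta> - cis \<eta>)"
  have c: "\<bar>cos \<theta> - cos \<eta>\<bar> \<le> ?d" and s: "\<bar>sin \<theta> - sin \<eta>\<bar> \<le> ?d"
    using abs_Re_le_cmod[of "cis \<theta> - cis \<eta>"] abs_Im_le_cmod[of "cis \<theta> - cis \<eta>"] by simp_all
  have le: "a *\<^sub>R z \<le> ?d *\<^sub>R \<bar>z\<bar>" if "\<bar>a\<bar> \<le> ?d" for a and z :: 'a
  proof -
    have "a *\<^sub>R z \<le> \<bar>a *\<^sub>R z\<bar>" by (rule abs_ge_self)
    also have "\<dots> = \<bar>a\<bar> *\<^sub>R \<bar>z\<bar>" by (rule abs_scaleR_lattice)
    also have "\<dots> \<le> ?d *\<^sub>R \<bar>z\<bar>" using that by (intro scaleR_right_mono) simp_all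
    finally show ?thesis .
  qed
  have "(cos \<theta> - cos \<eta>) *\<^sub>R x + (sin \<theta> - sin \<eta>) *\<^sub>R y \<le> ?d *\<^sub>R \<bar>x\<bar> + ?d *\<^sub>R \<bar>y\<bar>"
    by (intro add_mono le c s)
  then show ?thesis
    by (simp add: algebra_simps)
qed

lemma is_modulus_exists:
  fixes x y :: "'a::banach_lattice"
  shows "\<exists>m. is_modulus x y m"
proof -
  define g where "g \<theta> = cos \<theta> *\<^sub>R x + sin \<theta> *\<^sub>R y" for \<theta>
  define e where "e = \<bar>x\<bar> + \<bar>y\<bar>"
  have e0: "0 \<le> e" unfolding e_def by simp
  have "\<exists>F. finite F \<and> F \<noteq> {} \<and> (\<forall>\<theta>. \<exists>\<eta>\<in>F. norm (cis \<theta> - cis \<eta>) < 1 / real (Suc n))" for n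
    by (rule finite_cis_net[of "1 / real (Suc n)"]) auto
  then obtain F where F: "\<And>n. finite (F n)" "\<And>n. F n \<noteq> {}"
    "\<And>n \<theta>. \<exists>\<eta>\<in>F n. norm (cis \<theta> - cis \<eta>) < 1 / real (Suc n)"
    by metis
  define s where "s n = Sup_fin (g ` F n)" for n
  have g_le: "g \<theta> \<le> s n + (1 / real (Suc n)) *\<^sub>R e" for \<theta> n
  proof -
    obtain \<eta> where \<eta>: "\<eta> \<in> F n" "norm (cis \<theta> - cis \<eta>) < 1 / real (Suc n)"
      using F(3) by blast
    have "g \<theta> \<le> g \<eta> + norm (cis \<theta> - cis \<eta>) *\<^sub>R e"
      unfolding g_def e_def by (rule rotation_diff_le)
    also have "\<dots> \<le> s n + (1 / real (Suc n)) *\<^sub>R e"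
      unfolding s_def using \<eta> F(1) e0
      by (intro add_mono scaleR_right_mono Sup_fin.coboundedI) auto
    finally show ?thesis .
  qed
  have s_le: "s n \<le> b" if "\<And>\<theta>. g \<theta> \<le> b" for n b
    unfolding s_def using F(1,2) that by (intro Sup_fin.boundedI) auto
  have one: "s m - s n \<le> (1 / real (Suc n)) *\<^sub>R e" for m n
    using s_le[OF g_le, of m n] by (simp add: algebra_simps)
  have cauchy: "norm (s m - s n) \<le> (1 / real (Suc N)) * norm e" if "N \<le> m" "N \<le> n" for m n N
  proof -
    have *: "(1 / real (Suc k)) *\<^sub>R e \<le> (1 / real (Suc N)) *\<^sub>R e" if "N \<le> k" for k
      using that e0 by (intro scaleR_right_mono) (auto simp: field_simps)
    have "s m - s n \<le> (1 / real (Suc N)) *\<^sub>R e"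
      using one[of m n] *[OF that(2)] by (rule order_trans)
    moreover have "- (s m - s n) \<le> (1 / real (Suc N)) *\<^sub>R e"
      using order_trans[OF one[of n m] *[OF that(1)]] by simp
    ultimately have "\<bar>s m - s n\<bar> \<le> (1 / real (Suc N)) *\<^sub>R e" by (rule abs_leI)
    then have "norm (s m - s n) \<le> norm ((1 / real (Suc N)) *\<^sub>R e)"
      by (rule banach_lattice_norm_le)
    then show ?thesis by simp
  qed
  have lim0: "(\<lambda>n. 1 / real (Suc n)) \<longlonglongrightarrow> 0"
    using LIMSEQ_inverse_real_of_nat by (simp add: inverse_eq_divide)
  have "Cauchy s"
  proof (rule CauchyI)
    fix r :: real assume r: "r > 0"
    have "(\<lambda>n. (1 / real (Suc n)) * norm e) \<longlonglongrightarrow> 0 * norm e"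
      by (intro tendsto_mult lim0 tendsto_const)
    then have "\<forall>\<^sub>F n in sequentially. (1 / real (Suc n)) * norm e < r"
      using r by (intro order_tendstoD(2)) simp_all
    then obtain N where "(1 / real (Suc N)) * norm e < r"
      by (auto simp: eventually_sequentially)
    then show "\<exists>M. \<forall>m\<ge>M. \<forall>n\<ge>M. norm (s m - s n) < r"
      using cauchy by (meson le_less_trans)
  qed
  then obtain m where m: "s \<longlonglongrightarrow> m"
    using Cauchy_convergent convergent_def by blast
  have "(\<lambda>n. s n + (1 / real (Suc n)) *\<^sub>R e) \<longlonglongrightarrow> m + 0 *\<^sub>R e"
    by (intro tendsto_add tendsto_scaleR m lim0 tendsto_const)
  then have lim: "(\<lambda>n. s n + (1 / real (Suc n)) *\<^sub>R e) \<longlonglongrightarrow> m" by simp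
  have "is_modulus x y m"
    unfolding is_modulus_def
  proof (intro conjI allI impI)
    fix \<theta>
    have "g \<theta> \<le> m" by (rule banach_lattice_le_limit[OF tendsto_const lim g_le])
    then show "cos \<theta> *\<^sub>R x + sin \<theta> *\<^sub>R y \<le> m" by (simp add: g_def)
  next
    fix b assume "\<forall>\<theta>. cos \<theta> *\<^sub>R x + sin \<theta> *\<^sub>R y \<le> b"
    then have "s n \<le> b" for n by (intro s_le) (simp add: g_def)
    then show "m \<le> b" by (rule banach_lattice_le_limit[OF m tendsto_const])
  qed
  then show ?thesis by blast
qed

lemma is_modulus: "is_modulus x y (modulus x y)"
  unfolding modulus_def
  by (rule theI') (use is_modulus_exists is_modulus_unique in blast)

lemma modulus_eqI: "is_modulus x y m \<Longrightarrow> modulus x y = m"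
  using is_modulus is_modulus_unique by blast

lemma modulus_upper: "cos \<theta> *\<^sub>R x + sin \<theta> *\<^sub>R y \<le> modulus x y"
  using is_modulus unfolding is_modulus_def by blast

lemma modulus_least: "(\<And>\<theta>. cos \<theta> *\<^sub>R x + sin \<theta> *\<^sub>R y \<le> b) \<Longrightarrow> modulus x y \<le> b"
  using is_modulus unfolding is_modulus_def by blast

lemma abs_le_modulus1: "\<bar>x\<bar> \<le> modulus x y"
  using modulus_upper[of 0 x y] modulus_upper[of pi x y] by (intro abs_leI) simp_all

lemma abs_le_modulus2: "\<bar>y\<bar> \<le> modulus x y"
  using modulus_upper[of "pi / 2" x y] modulus_upper[of "- (pi / 2)" x y]
  by (intro abs_leI) simp_all

lemma modulus_nonneg: "0 \<le> modulus x y"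
  using abs_le_modulus1[of x y] abs_ge_zero order_trans by blast

lemma modulus_le: "modulus x y \<le> \<bar>x\<bar> + \<bar>y\<bar>"
proof (rule modulus_least)
  fix \<theta>
  have le: "a *\<^sub>R z \<le> \<bar>z\<bar>" if "\<bar>a\<bar> \<le> 1" for a and z :: 'a
  proof -
    have "a *\<^sub>R z \<le> \<bar>a *\<^sub>R z\<bar>" by (rule abs_ge_self)
    also have "\<dots> = \<bar>a\<bar> *\<^sub>R \<bar>z\<bar>" by (rule abs_scaleR_lattice)
    also have "\<dots> \<le> 1 *\<^sub>R \<bar>z\<bar>" using that by (intro scaleR_right_mono) simp_all
    finally show ?thesis by simp
  qed
  show "cos \<theta> *\<^sub>R x + sin \<theta> *\<^sub>R y \<le> \<bar>x\<bar> + \<bar>y\<bar>"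
    by (intro add_mono le) simp_all
qed

lemma modulus_real: "modulus x 0 = \<bar>x\<bar>"
  using abs_le_modulus1[of x 0] modulus_le[of x 0] by simp

lemma modulus_triangle: "modulus (x + x') (y + y') \<le> modulus x y + modulus x' y'"
proof (rule modulus_least)
  fix \<theta>
  show "cos \<theta> *\<^sub>R (x + x') + sin \<theta> *\<^sub>R (y + y') \<le> modulus x y + modulus x' y'"
    using add_mono[OF modulus_upper[of \<theta> x y] modulus_upper[of \<theta> x' y']]
    by (simp add: algebra_simps)
qed

lemma modulus_cscale_le:
  "modulus (Re c *\<^sub>R x - Im c *\<^sub>R y) (Re c *\<^sub>R y + Im c *\<^sub>R x) \<le> cmod c *\<^sub>R modulus x y"
proof (rule modulus_least)
  fix \<theta>
  define \<alpha> where "\<alpha> = Arg c"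
  have c: "Re c = cmod c * cos \<alpha>" "Im c = cmod c * sin \<alpha>"
    using rcis_cmod_Arg[of c] unfolding \<alpha>_def by (metis Re_rcis, metis Im_rcis)
  have "cos \<theta> *\<^sub>R (Re c *\<^sub>R x - Im c *\<^sub>R y) + sin \<theta> *\<^sub>R (Re c *\<^sub>R y + Im c *\<^sub>R x)
      = (cos \<theta> * Re c + sin \<theta> * Im c) *\<^sub>R x + (sin \<theta> * Re c - cos \<theta> * Im c) *\<^sub>R y"
    by (simp add: algebra_simps)
  also have "\<dots> = cmod c *\<^sub>R (cos (\<theta> - \<alpha>) *\<^sub>R x + sin (\<theta> - \<alpha>) *\<^sub>R y)"
    unfolding c cos_diff sin_diff by (simp add: algebra_simps)
  also have "\<dots> \<le> cmod c *\<^sub>R modulus x y"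
    by (intro scaleR_left_mono modulus_upper) simp
  finally show "cos \<theta> *\<^sub>R (Re c *\<^sub>R x - Im c *\<^sub>R y) + sin \<theta> *\<^sub>R (Re c *\<^sub>R y + Im c *\<^sub>R x)
      \<le> cmod c *\<^sub>R modulus x y" .
qed

section \<open>Complex Banach lattices\<close>

text \<open>A complex Banach lattice is the complexification \<open>E = E\<^sub>\<real> + i E\<^sub>\<real>\<close> of a real Banach
  lattice \<open>E\<^sub>\<real>\<close> (here the type variable) with the norm \<open>\<parallel>z\<parallel> = \<parallel>|z|\<parallel>\<close>;
  \<open>Cplx x y\<close> stands for \<open>x + iy\<close>.\<close>

datatype 'a complexification = Cplx (re: 'a) (im: 'a)

instantiation complexification :: (banach_lattice) real_normed_vector
begin

definition "0 = Cplx 0 0"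
definition "z + w = Cplx (re z + re w) (im z + im w)"
definition "- z = Cplx (- re z) (- im z)"
definition "z - w = Cplx (re z - re w) (im z - im w)"
definition "a *\<^sub>R z = Cplx (a *\<^sub>R re z) (a *\<^sub>R im z)"
definition norm_complexification :: "'a complexification \<Rightarrow> real" where
  "norm z = norm (modulus (re z) (im z))"
definition "sgn (z::'a complexification) = inverse (norm z) *\<^sub>R z"
definition "dist (z::'a complexification) w = norm (z - w)"
definition "uniformity =
  (INF e\<in>{0<..}. principal {(z::'a complexification, w). dist z w < e})"
definition "open (U :: 'a complexification set) \<longleftrightarrow>
  (\<forall>z\<in>U. \<forall>\<^sub>F (z', w) in uniformity. z' = z \<longrightarrow> w \<in> U)"

lemmas complexification_ops = zero_complexification_def plus_complexification_def
  uminus_complexification_def minus_complexification_def scaleR_complexification_def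

instance
proof
  fix z w :: "'a complexification" and a :: real
  show "norm z = 0 \<longleftrightarrow> z = 0"
  proof
    assume "norm z = 0"
    then have "modulus (re z) (im z) = 0" by (simp add: norm_complexification_def)
    then show "z = 0"
      using abs_le_modulus1[of "re z" "im z"] abs_le_modulus2[of "im z" "re z"]
      by (cases z) (simp add: zero_complexification_def)
  next
    assume "z = 0"
    then show "norm z = 0"
      by (simp add: norm_complexification_def zero_complexification_def modulus_real)
  qed
  have "norm (z + w) \<le> norm (modulus (re z) (im z) + modulus (re w) (im w))"
    unfolding norm_complexification_def plus_complexification_def
    by (intro banach_lattice_norm_mono) (simp_all add: modulus_nonneg modulus_triangle)
  also have "\<dots> \<le> norm z + norm w"
    unfolding norm_complexification_def by (rule norm_triangle_ineq)
  finally show "norm (z + w) \<le> norm z + norm w" .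
  have le: "norm (b *\<^sub>R v) \<le> \<bar>b\<bar> * norm v" for b and v :: "'a complexification"
  proof -
    have "norm (b *\<^sub>R v) \<le> norm (\<bar>b\<bar> *\<^sub>R modulus (re v) (im v))"
      unfolding norm_complexification_def scaleR_complexification_def
      using modulus_cscale_le[of "complex_of_real b" "re v" "im v"]
      by (intro banach_lattice_norm_mono) (simp_all add: modulus_nonneg)
    then show ?thesis by (simp add: norm_complexification_def)
  qed
  show "norm (a *\<^sub>R z) = \<bar>a\<bar> * norm z"
  proof (cases "a = 0")
    case True
    then show ?thesis using le[of a z]
      by (simp add: norm_complexification_def)
  next
    case False
    have "inverse a *\<^sub>R a *\<^sub>R z = z"
      using False by (cases z) (simp add: scaleR_complexification_def)
    then have "norm z \<le> \<bar>inverse a\<bar> * norm (a *\<^sub>R z)" using le[of "inverse a" "a *\<^sub>R z"] by simp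
    then have "\<bar>a\<bar> * norm z \<le> norm (a *\<^sub>R z)"
      using False by (simp add: abs_inverse field_simps)
    then show ?thesis using le[of a z] by simp
  qed
qed (auto simp: complexification_ops algebra_simps sgn_complexification_def
    dist_complexification_def uniformity_complexification_def open_complexification_def
    complexification.expand)

end

lemma re_im_simps [simp]:
  "re 0 = 0" "im 0 = 0"
  "re (z + w) = re z + re w" "im (z + w) = im z + im w"
  "re (- z) = - re z" "im (- z) = - im z"
  "re (z - w) = re z - re w" "im (z - w) = im z - im w"
  "re (a *\<^sub>R z) = a *\<^sub>R re z" "im (a *\<^sub>R z) = a *\<^sub>R im z"
  by (simp_all add: complexification_ops)

lemma norm_re_le: "norm (re z) \<le> norm z"
  unfolding norm_complexification_def
  by (intro banach_lattice_norm_le abs_le_modulus1)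

lemma norm_im_le: "norm (im z) \<le> norm z"
  unfolding norm_complexification_def
  by (intro banach_lattice_norm_le abs_le_modulus2)

lemma norm_complexification_le: "norm z \<le> norm (re z) + norm (im z)"
proof -
  have "norm z \<le> norm (\<bar>re z\<bar> + \<bar>im z\<bar>)"
    unfolding norm_complexification_def
    by (intro banach_lattice_norm_mono modulus_nonneg modulus_le)
  also have "\<dots> \<le> norm (re z) + norm (im z)"
    using norm_triangle_ineq[of "\<bar>re z\<bar>" "\<bar>im z\<bar>"] by (simp add: norm_abs_lattice)
  finally show ?thesis .
qed

lemma bounded_linear_re: "bounded_linear re"
  by (rule bounded_linear_intro[where K = 1]) (auto simp: norm_re_le)

lemma bounded_linear_im: "bounded_linear im"
  by (rule bounded_linear_intro[where K = 1]) (auto simp: norm_im_le)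

instance complexification :: (banach_lattice) banach
proof
  fix X :: "nat \<Rightarrow> 'a complexification"
  assume X: "Cauchy X"
  obtain x y where xy: "(\<lambda>n. re (X n)) \<longlonglongrightarrow> x" "(\<lambda>n. im (X n)) \<longlonglongrightarrow> y"
    using bounded_linear.Cauchy[OF bounded_linear_re X]
      bounded_linear.Cauchy[OF bounded_linear_im X]
    by (meson Cauchy_convergent convergent_def)
  have "(\<lambda>n. norm (re (X n) - x) + norm (im (X n) - y)) \<longlonglongrightarrow> 0 + 0"
    by (intro tendsto_add tendsto_norm_zero LIM_zero xy)
  then have lim: "(\<lambda>n. norm (re (X n) - x) + norm (im (X n) - y)) \<longlonglongrightarrow> 0"
    by simp
  have "norm (X n - Cplx x y) \<le> norm (re (X n) - x) + norm (im (X n) - y)" for n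
    using norm_complexification_le[of "X n - Cplx x y"] by simp
  then have "(\<lambda>n. X n - Cplx x y) \<longlonglongrightarrow> 0"
    by (intro Lim_null_comparison[OF _ lim] eventuallyI)
  then show "convergent X"
    unfolding convergent_def using LIM_zero_iff by blast
qed

text \<open>Two elements are comparable only if their difference lies in the real part.\<close>

instantiation complexification :: (banach_lattice) order
begin

definition "z \<le> w \<longleftrightarrow> re z \<le> re w \<and> im z = im w"
definition "(z :: 'a complexification) < w \<longleftrightarrow> z \<le> w \<and> \<not> w \<le> z"

instance
  by standard (auto simp: less_eq_complexification_def less_complexification_def
      complexification.expand)

end

instance complexification :: (banach_lattice) ordered_real_vector
  by standard (auto simp: less_eq_complexification_def scaleR_left_mono scaleR_right_mono)

instantiation complexification :: (banach_lattice) abs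
begin

definition abs_complexification :: "'a complexification \<Rightarrow> 'a complexification" where
  "\<bar>z\<bar> = Cplx (modulus (re z) (im z)) 0"

instance ..

end

definition cscale :: "complex \<Rightarrow> 'a::banach_lattice complexification \<Rightarrow> 'a complexification" where
  "cscale c z = Cplx (Re c *\<^sub>R re z - Im c *\<^sub>R im z) (Re c *\<^sub>R im z + Im c *\<^sub>R re z)"

global_interpretation complexification: vector_space cscale
  by standard (auto simp: cscale_def complexification_ops algebra_simps)

lemma cscale_of_real: "cscale (complex_of_real a) z = a *\<^sub>R z"
  by (simp add: cscale_def scaleR_complexification_def)

lemma norm_cscale: "norm (cscale c z) = cmod c * norm z"
proof -
  have le: "norm (cscale c z) \<le> cmod c * norm z" for c and z :: "'a complexification"
  proof -
    have "norm (cscale c z) \<le> norm (cmod c *\<^sub>R modulus (re z) (im z))"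
      unfolding norm_complexification_def cscale_def complexification.sel
      by (intro banach_lattice_norm_mono modulus_nonneg modulus_cscale_le)
    then show ?thesis by (simp add: norm_complexification_def)
  qed
  show ?thesis
  proof (cases "c = 0")
    case False
    have "norm z \<le> cmod (inverse c) * norm (cscale c z)"
      using le[of "inverse c" "cscale c z"] False by simp
    then have "cmod c * norm z \<le> norm (cscale c z)"
      using False by (simp only: norm_inverse) (simp add: field_simps)
    then show ?thesis using le[of c z] by simp
  qed simp
qed

definition real_part :: "'a::banach_lattice complexification set" where
  "real_part = {z. im z = 0}"

definition principal_ideal ::
  "'a::banach_lattice complexification \<Rightarrow> 'a complexification set" where
  "principal_ideal u = {f. \<exists>c>0. \<bar>f\<bar> \<le> c *\<^sub>R u}"

definition quasi_interior :: "'a::banach_lattice complexification \<Rightarrow> bool" where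
  "quasi_interior u \<longleftrightarrow> 0 \<le> u \<and> closure (principal_ideal u) = UNIV"

section \<open>Operators, functionals and semigroups\<close>

definition bounded_op ::
  "('a::banach_lattice complexification \<Rightarrow> 'a complexification) \<Rightarrow> bool" where
  "bounded_op S \<longleftrightarrow> bounded_linear S \<and> (\<forall>c f. S (cscale c f) = cscale c (S f))"

definition dual_space :: "('a::banach_lattice complexification \<Rightarrow> complex) set" where
  "dual_space = {\<phi>. bounded_linear \<phi> \<and> (\<forall>c f. \<phi> (cscale c f) = c * \<phi> f)}"

definition real_op ::
  "('a::banach_lattice complexification \<Rightarrow> 'a complexification) \<Rightarrow> bool" where
  "real_op S \<longleftrightarrow> S ` real_part \<subseteq> real_part"

definition strictly_positive :: "('a::banach_lattice complexification \<Rightarrow> complex) \<Rightarrow> bool" where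
  "strictly_positive \<phi> \<longleftrightarrow> (\<forall>f. 0 \<le> f \<and> f \<noteq> 0 \<longrightarrow> \<phi> f \<in> \<real> \<and> 0 < Re (\<phi> f))"

definition tensor_op ::
  "'a::banach_lattice complexification \<Rightarrow> ('a complexification \<Rightarrow> complex)
     \<Rightarrow> 'a complexification \<Rightarrow> 'a complexification" where
  "tensor_op u \<phi> = (\<lambda>f. cscale (\<phi> f) u)"

definition rank_one_projection ::
  "('a::banach_lattice complexification \<Rightarrow> 'a complexification) \<Rightarrow> bool" where
  "rank_one_projection P \<longleftrightarrow>
     bounded_op P \<and> P \<circ> P = P \<and> complexification.dim (range P) = 1"

text \<open>Only the values \<open>T t\<close> for \<open>t \<ge> 0\<close> are relevant.\<close>

definition C0_semigroup ::
  "(real \<Rightarrow> 'a::banach_lattice complexification \<Rightarrow> 'a complexification) \<Rightarrow> bool" where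
  "C0_semigroup T \<longleftrightarrow>
     (\<forall>t\<ge>0. bounded_op (T t)) \<and>
     T 0 = id \<and>
     (\<forall>s\<ge>0. \<forall>t\<ge>0. T (s + t) = T s \<circ> T t) \<and>
     (\<forall>f. ((\<lambda>t. T t f) \<longlongrightarrow> f) (at_right 0))"

text \<open>Unbounded operators are represented by their graphs: \<open>(f, g) \<in> A\<close> means that \<open>f\<close> is in
  the domain of \<open>A\<close> and \<open>A f = g\<close>. For densely defined \<open>A\<close> (such as a generator) the relation
  \<open>dual_operator A\<close> is the graph of the dual operator on the dual space.\<close>

definition generator ::
  "(real \<Rightarrow> 'a::banach_lattice complexification \<Rightarrow> 'a complexification)
     \<Rightarrow> ('a complexification \<times> 'a complexification) set" where
  "generator T = {(f, g). ((\<lambda>h. (T h f - f) /\<^sub>R h) \<longlongrightarrow> g) (at_right 0)}"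

definition dual_operator ::
  "('a::banach_lattice complexification \<times> 'a complexification) set
     \<Rightarrow> (('a complexification \<Rightarrow> complex) \<times> ('a complexification \<Rightarrow> complex)) set" where
  "dual_operator A =
     {(\<phi>, \<psi>). \<phi> \<in> dual_space \<and> \<psi> \<in> dual_space \<and> (\<forall>(f, g)\<in>A. \<phi> g = \<psi> f)}"

definition op_kernel ::
  "('a::banach_lattice complexification \<times> 'a complexification) set \<Rightarrow> 'a complexification set"
  where "op_kernel A = {f. (f, 0) \<in> A}"

definition dual_op_kernel ::
  "(('a::banach_lattice complexification \<Rightarrow> complex) \<times> ('a complexification \<Rightarrow> complex)) set
     \<Rightarrow> ('a complexification \<Rightarrow> complex) set"
  where "dual_op_kernel B = {\<phi>. (\<phi>, \<lambda>_. 0) \<in> B}"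

definition individually_eventually_positive ::
  "(real \<Rightarrow> 'a::banach_lattice complexification \<Rightarrow> 'a complexification) \<Rightarrow> bool" where
  "individually_eventually_positive T \<longleftrightarrow> (\<forall>f\<ge>0. \<exists>t0\<ge>0. \<forall>t\<ge>t0. 0 \<le> T t f)"

definition relatively_compact_orbits ::
  "(real \<Rightarrow> 'a::banach_lattice complexification \<Rightarrow> 'a complexification) \<Rightarrow> bool" where
  "relatively_compact_orbits T \<longleftrightarrow> (\<forall>f. compact (closure ((\<lambda>t. T t f) ` {0..})))"

definition converges_strongly ::
  "(real \<Rightarrow> 'a::banach_lattice complexification \<Rightarrow> 'a complexification)
     \<Rightarrow> ('a complexification \<Rightarrow> 'a complexification) \<Rightarrow> bool" where
  "converges_strongly T P \<longleftrightarrow> (\<forall>f. ((\<lambda>t. T t f) \<longlongrightarrow> P f) at_top)"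

end

theory Submission
  imports Defs
begin

text \<open>On the real part, let \<open>L\<close> be the set of all limits of \<open>S(t)\<close> along filters tending to infinity,
  taken in the strong operator topology. By Tychonoff and relatively compact orbits, \<open>L\<close> is a
  nonempty compact set, and it is a commutative group under composition; since \<open>S(t) f\<close> is
  positive for large \<open>t\<close> whenever \<open>f \<ge> 0\<close>, every element of \<open>L\<close> is a positive operator, although
  the \<open>S(t)\<close> need not be. The unit \<open>P\<close> of \<open>L\<close> is a positive projection, and \<open>S(t)\<close> acts on its
  range as a group of order isomorphisms. If \<open>P \<noteq> 0\<close>, then the quasi-interior points in the
  orbits force \<open>P\<close> to be strictly positive and forbid two nonzero disjoint positive elements in
  its range. So the range is totally ordered, hence one-dimensional, and boundedness makes
  \<open>S(t)\<close> the identity there. As \<open>P\<close> is a cluster point of \<open>S(t)\<close>, the semigroup converges to \<open>P\<close>.\<close>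

subsection \<open>Cluster points along filters\<close>

text \<open>The refinement is the infimum of \<open>F\<close> with the pullback of the neighbourhood
  filter of \<open>x\<close>; that \<open>f\<close> is frequently in every neighbourhood says
  exactly that this infimum is proper. Filters stand in for subnets, since pointwise convergence of
  operators need not be metrizable.\<close>

lemma tendsto_refine_filter:
  assumes "\<And>U. open U \<Longrightarrow> x \<in> U \<Longrightarrow> \<exists>\<^sub>F t in F. f t \<in> U"
  obtains F' where "F' \<noteq> bot" "F' \<le> F" "(f \<longlongrightarrow> x) F'"
proof
  let ?F = "inf F (filtercomap f (nhds x))"
  show "?F \<noteq> bot"
  proof
    assume "?F = bot"
    then have "eventually (\<lambda>_. False) ?F" by simp
    then obtain P Q where PQ: "eventually P F" "eventually Q (filtercomap f (nhds x))"
      "\<And>t. P t \<Longrightarrow> Q t \<Longrightarrow> False"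
      unfolding eventually_inf by blast
    then obtain U where U: "open U" "x \<in> U" "\<And>t. f t \<in> U \<Longrightarrow> Q t"
      unfolding eventually_filtercomap_nhds by blast
    show False
      using frequently_eventually_conj[OF assms[OF U(1,2)] PQ(1)] U(3) PQ(3)
      by (auto dest!: frequently_ex)
  qed
  show "(f \<longlongrightarrow> x) ?F"
    by (rule filterlim_mono[OF filterlim_filtercomap]) auto
qed simp

text \<open>The topology on a function type is the product topology, so for operators its limits are
  the strong ones.\<close>

lemma tendsto_fun_iff:
  fixes f :: "'b \<Rightarrow> 'i \<Rightarrow> 'c::topological_space"
  shows "(f \<longlongrightarrow> l) F \<longleftrightarrow> (\<forall>i. ((\<lambda>x. f x i) \<longlongrightarrow> l i) F)"
  using limitin_componentwise[of "\<lambda>_. euclidean" UNIV f l F]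
  by (simp add: euclidean_product_topology)

text \<open>By Tychonoff the product of the \<open>K i\<close> is compact, so the image filter has a
  cluster point, and \<open>F\<close> can be refined to converge to it.\<close>

lemma tychonoff_refine_filter:
  fixes f :: "'b \<Rightarrow> 'i \<Rightarrow> 'c::topological_space"
  assumes "F \<noteq> bot" "\<And>i. compact (K i)" "\<forall>\<^sub>F x in F. \<forall>i. f x i \<in> K i"
  obtains F' l where "F' \<noteq> bot" "F' \<le> F" "(f \<longlongrightarrow> l) F'"
proof -
  have "compact (\<Pi>\<^sub>E i\<in>UNIV. K i)"
    using compactin_PiE[of "\<lambda>_. euclidean :: 'c topology" UNIV K] assms(2)
    by (simp add: euclidean_product_topology)
  moreover have "filtermap f F \<noteq> bot" "\<forall>\<^sub>F g in filtermap f F. g \<in> (\<Pi>\<^sub>E i\<in>UNIV. K i)"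
    using assms(1,3) by (auto simp: eventually_filtermap filtermap_bot_iff PiE_UNIV_domain elim!: eventually_mono)
  ultimately obtain l where l: "inf (nhds l) (filtermap f F) \<noteq> bot"
    unfolding compact_filter by blast
  have "\<exists>\<^sub>F t in F. f t \<in> U" if "open U" "l \<in> U" for U
  proof (rule ccontr)
    assume "\<not> ?thesis"
    then have "\<forall>\<^sub>F g in filtermap f F. g \<notin> U" by (simp add: not_frequently eventually_filtermap)
    moreover have "\<forall>\<^sub>F g in nhds l. g \<in> U" using that by (rule eventually_nhds_in_open)
    ultimately have "\<forall>\<^sub>F g in inf (nhds l) (filtermap f F). False"
      unfolding eventually_inf by blast
    then show False using l by (simp add: trivial_limit_def)
  qed
  then show ?thesis using tendsto_refine_filter[of l f F] that by blast
qed

text \<open>Baire's theorem: the closed sets \<open>C n\<close> cover the space, so one of them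
  contains a ball, and subtracting the value at its centre moves the bound to the origin.\<close>

lemma uniform_boundedness:
  fixes S :: "'i \<Rightarrow> 'a::banach \<Rightarrow> 'b::real_normed_vector"
  assumes lin: "\<And>i. i \<in> I \<Longrightarrow> bounded_linear (S i)"
    and bdd: "\<And>f. bounded ((\<lambda>i. S i f) ` I)"
  obtains M where "M > 0" "\<And>i f. i \<in> I \<Longrightarrow> norm (S i f) \<le> M * norm f"
proof -
  define C where "C n = {f. \<forall>i\<in>I. norm (S i f) \<le> real n}" for n
  have closed: "closed (C n)" for n
  proof -
    have C: "C n = (\<Inter>i\<in>I. {f. norm (S i f) \<le> real n})" unfolding C_def by auto
    have "closed {f. norm (S i f) \<le> real n}" if "i \<in> I" for i
      by (intro closed_Collect_le continuous_on_norm continuous_on_const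
          bounded_linear.continuous_on[OF lin[OF that]] continuous_on_id)
    then show ?thesis unfolding C by (intro closed_INT ballI)
  qed
  have "\<exists>n. interior (C n) \<noteq> {}"
  proof (rule ccontr)
    assume *: "\<nexists>n. interior (C n) \<noteq> {}"
    have "euclidean interior_of \<Union>(range C) = ({} :: 'a set)"
    proof (rule Baire_category_alt)
      show "completely_metrizable_space (euclidean :: 'a topology) \<or>
          locally_compact_space (euclidean :: 'a topology) \<and> regular_space (euclidean :: 'a topology)"
        by (simp add: completely_metrizable_space_euclidean)
    qed (use closed * in auto)
    moreover have "\<Union>(range C) = UNIV"
    proof -
      have "\<exists>n. f \<in> C n" for f
      proof -
        obtain b where "\<And>i. i \<in> I \<Longrightarrow> norm (S i f) \<le> b" using bdd[of f] by (auto simp: bounded_iff)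
        moreover obtain n where "b \<le> real n" using real_arch_simple by blast
        ultimately show ?thesis unfolding C_def by (auto intro: order_trans)
      qed
      then show ?thesis by blast
    qed
    ultimately show False by simp
  qed
  then obtain n x where "x \<in> interior (C n)" by blast
  then obtain e where e: "e > 0" "cball x e \<subseteq> C n" by (meson interior_subset mem_interior_cball)
  show ?thesis
  proof
    \<comment> \<open>The summand \<open>1\<close> keeps the constant positive when
      \<open>n = 0\<close>.\<close>
    show "(2 * real n + 1) / e > 0" using e(1) by (simp add: add_nonneg_pos)
    fix i f assume i: "i \<in> I"
    interpret Si: bounded_linear "S i" using lin[OF i] .
    have C: "norm (S i y) \<le> real n" if "y \<in> cball x e" for y
      using e(2) that i unfolding C_def by blast
    show "norm (S i f) \<le> (2 * real n + 1) / e * norm f"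
    proof (cases "f = 0")
      case False
      define g where "g = (e / norm f) *\<^sub>R f"
      have "norm g = e" using False e(1) by (simp add: g_def)
      then have "norm (S i (x + g)) \<le> real n" "norm (S i x) \<le> real n"
        using e(1) by (auto intro!: C simp: dist_norm)
      moreover have "S i g = S i (x + g) - S i x" by (simp add: Si.add)
      ultimately have "norm (S i g) \<le> 2 * real n + 1"
        using norm_triangle_ineq4[of "S i (x + g)" "S i x"] by simp
      then show ?thesis using False e(1) by (simp add: g_def Si.scaleR field_simps)
    qed (simp add: Si.zero)
  qed
qed

subsection \<open>Real Banach lattices\<close>

lemma closed_positive_cone: "closed {x::'a::banach_lattice. 0 \<le> x}"
  unfolding closed_sequential_limits by (auto intro: banach_lattice_nonneg_limit)

lemma positive_op_mono:
  fixes P :: "'a::ordered_ab_group_add \<Rightarrow> 'b::ordered_ab_group_add"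
  assumes "\<And>x y. P (x - y) = P x - P y" "\<And>x. 0 \<le> x \<Longrightarrow> 0 \<le> P x" "x \<le> y"
  shows "P x \<le> P y"
  using assms(1)[of y x] assms(2)[of "y - x"] assms(3) by simp

text \<open>With \<open>d = max c 1\<close>, the infimum lies below both
  \<open>d *\<^sub>R h\<close> and \<open>d *\<^sub>R k\<close>; dividing by \<open>d\<close> puts
  it below \<open>inf h k\<close>.\<close>

lemma inf_scaleR_eq_0:
  fixes h k :: "'a::banach_lattice"
  assumes "0 \<le> h" "0 \<le> k" "inf h k = 0" "c > 0"
  shows "inf (c *\<^sub>R h) k = 0"
proof (rule order.antisym)
  define d where "d = max c 1"
  have d: "d > 0" "c \<le> d" "1 \<le> d" unfolding d_def by auto
  let ?m = "inf (c *\<^sub>R h) k"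
  have "?m \<le> d *\<^sub>R h"
    using scaleR_right_mono[OF d(2) assms(1)] by (meson inf_le1 order_trans)
  moreover have "?m \<le> d *\<^sub>R k"
    using scaleR_right_mono[OF d(3) assms(2)] by (metis inf_le2 order_trans scaleR_one)
  ultimately have "inverse d *\<^sub>R ?m \<le> h" "inverse d *\<^sub>R ?m \<le> k"
    using d(1) scaleR_left_mono[of ?m _ "inverse d"] by force+
  then have "inverse d *\<^sub>R ?m \<le> 0" using assms(3) by (metis le_inf_iff)
  then show "?m \<le> 0" using scaleR_left_mono[of "inverse d *\<^sub>R ?m" 0 d] d(1) by simp
  show "0 \<le> ?m" using assms by (simp add: scaleR_nonneg_nonneg)
qed

text \<open>The density half of being a quasi-interior point, on the real part; positivity is kept
  separate.\<close>

definition dense_ideal :: "'a::banach_lattice \<Rightarrow> bool" where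
  "dense_ideal h \<longleftrightarrow> closure {g. \<exists>c>0. \<bar>g\<bar> \<le> c *\<^sub>R h} = UNIV"

text \<open>An element disjoint from \<open>h\<close> is disjoint from the whole ideal of
  \<open>h\<close>, hence at distance at least \<open>norm k\<close> from it, which density forbids
  unless \<open>k = 0\<close>.\<close>

lemma dense_ideal_disjoint:
  assumes h: "dense_ideal h" "0 \<le> h" and k: "0 \<le> k" and disj: "inf h k = 0"
  shows "k = 0"
proof -
  have *: "norm k \<le> norm (k - g)" if "\<bar>g\<bar> \<le> c *\<^sub>R h" "c > 0" for g c
  proof -
    have "inf \<bar>g\<bar> k \<le> inf (c *\<^sub>R h) k" using that(1) by (intro inf_mono) auto
    then have "inf \<bar>g\<bar> k \<le> 0" using inf_scaleR_eq_0[OF h(2) k disj that(2)] by simp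
    \<comment> \<open>Lying below both \<open>\<bar>g\<bar>\<close> and \<open>k\<close>, this
      difference lies below their infimum, so \<open>k \<le> \<bar>k - g\<bar>\<close>.\<close>
    moreover have "k - \<bar>k - g\<bar> \<le> \<bar>g\<bar>"
    proof -
      have "k \<le> \<bar>k\<bar>" by (rule abs_ge_self)
      also have "\<dots> \<le> \<bar>k - g\<bar> + \<bar>g\<bar>" using abs_triangle_ineq[of "k - g" g] by simp
      finally show ?thesis by (simp add: algebra_simps)
    qed
    moreover have "k - \<bar>k - g\<bar> \<le> k" by simp
    ultimately have "k - \<bar>k - g\<bar> \<le> 0" by (meson le_inf_iff order_trans)
    then have "norm k \<le> norm \<bar>k - g\<bar>" using k by (intro banach_lattice_norm_mono) auto
    then show ?thesis by (simp add: norm_abs_lattice)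
  qed
  have "norm k \<le> e" if e: "e > 0" for e
  proof -
    have "k \<in> closure {g. \<exists>c>0. \<bar>g\<bar> \<le> c *\<^sub>R h}" using h(1) by (simp add: dense_ideal_def)
    then obtain g c where "\<bar>g\<bar> \<le> c *\<^sub>R h" "c > 0" "dist g k < e"
      using e unfolding closure_approachable by blast
    then show ?thesis using *[of g c] by (simp add: dist_norm norm_minus_commute)
  qed
  then have "norm k \<le> 0" using field_le_epsilon[of "norm k" 0] by simp
  then show ?thesis by simp
qed

text \<open>On the ideal of \<open>h\<close>, positivity squeezes \<open>P g\<close> between
  multiples of \<open>P h = 0\<close>; continuity extends this to the closure.\<close>

lemma dense_ideal_positive_op:
  fixes P :: "'a::banach_lattice \<Rightarrow> 'a"
  assumes h: "dense_ideal h" and P: "bounded_linear P" "\<And>x. 0 \<le> x \<Longrightarrow> 0 \<le> P x" "P h = 0"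
  shows "P k = 0"
proof -
  interpret P: bounded_linear P by fact
  have "P g = 0" if "\<bar>g\<bar> \<le> c *\<^sub>R h" "c > 0" for g c
  proof -
    have "- g \<le> c *\<^sub>R h" "g \<le> c *\<^sub>R h"
      using that(1) abs_ge_self abs_ge_minus_self order_trans by blast+
    then have "P g \<le> P (c *\<^sub>R h)" "P (- g) \<le> P (c *\<^sub>R h)"
      by (auto intro!: positive_op_mono[of P] P(2) simp: P.diff)
    then show ?thesis using P(3) by (simp add: P.scaleR P.neg)
  qed
  then have "{g. \<exists>c>0. \<bar>g\<bar> \<le> c *\<^sub>R h} \<subseteq> {x. P x = 0}" by blast
  moreover have "closed {x. P x = 0}"
    by (intro closed_Collect_eq continuous_intros P.continuous_on)
  ultimately have "closure {g. \<exists>c>0. \<bar>g\<bar> \<le> c *\<^sub>R h} \<subseteq> {x. P x = 0}" by (rule closure_minimal)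
  then show ?thesis using h by (auto simp: dense_ideal_def)
qed

text \<open>Connectedness of the real line: the coefficients with \<open>c *\<^sub>R u\<close> above
  \<open>f\<close> and those with it below form two nonempty closed sets covering the line, so they
  share a point, where antisymmetry gives equality.\<close>

lemma comparable_imp_multiple:
  fixes f u :: "'a::banach_lattice"
  assumes u: "0 \<le> u" "u \<noteq> 0" and cmp: "\<And>c. f \<le> c *\<^sub>R u \<or> c *\<^sub>R u \<le> f"
  shows "\<exists>c. f = c *\<^sub>R u"
proof -
  define A where "A = {c. 0 \<le> c *\<^sub>R u - f}"
  define B where "B = {c. 0 \<le> f - c *\<^sub>R u}"
  have cl: "closed A" "closed B"
    unfolding A_def B_def
    using closed_vimage[OF closed_positive_cone, of "\<lambda>c. c *\<^sub>R u - f"]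
      closed_vimage[OF closed_positive_cone, of "\<lambda>c. f - c *\<^sub>R u"]
    by (simp_all add: vimage_def continuous_intros)
  have cover: "UNIV \<subseteq> A \<union> B" using cmp unfolding A_def B_def by auto
  \<comment> \<open>Archimedean property: otherwise \<open>u\<close> would lie below every
    \<open>g / n\<close>, hence below \<open>0\<close>.\<close>
  have *: "\<exists>c. \<not> c *\<^sub>R u \<le> g" for g
  proof (rule ccontr)
    assume "\<nexists>c. \<not> c *\<^sub>R u \<le> g"
    then have le: "c *\<^sub>R u \<le> g" for c by blast
    have "u \<le> (1 / real (Suc n)) *\<^sub>R g" for n
      using scaleR_left_mono[OF le[of "real (Suc n)"], of "1 / real (Suc n)"] by simp
    moreover have "(\<lambda>n. (1 / real (Suc n)) *\<^sub>R g) \<longlonglongrightarrow> 0 *\<^sub>R g"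
      using LIMSEQ_inverse_real_of_nat by (intro tendsto_scaleR) (auto simp: inverse_eq_divide)
    ultimately have "u \<le> 0" using banach_lattice_le_limit[OF tendsto_const, of _ "0 *\<^sub>R g" u] by force
    then show False using u by simp
  qed
  have "A \<noteq> {}"
  proof -
    obtain c where "\<not> c *\<^sub>R u \<le> f" using * by blast
    then show ?thesis using cmp unfolding A_def by force
  qed
  moreover have "B \<noteq> {}"
  proof -
    obtain c where "\<not> c *\<^sub>R u \<le> - f" using * by blast
    then have "\<not> f \<le> (- c) *\<^sub>R u" by (metis minus_le_iff scaleR_minus_left le_minus_iff)
    then have "(- c) *\<^sub>R u \<le> f" using cmp by blast
    then show ?thesis unfolding B_def by (simp only: diff_ge_0_iff_ge) blast
  qed
  ultimately have "A \<inter> B \<noteq> {}"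
    using cl cover connected_UNIV[where 'a=real] unfolding connected_closed by blast
  then show ?thesis unfolding A_def B_def by (auto intro: order.antisym)
qed

subsection \<open>Limit operators of a real semigroup\<close>

text \<open>This captures the action on the real part. Compactness is phrased as containment in some
  compact set because that form passes through the continuous map \<open>re\<close>.\<close>

locale real_semigroup =
  fixes S :: "real \<Rightarrow> 'a::banach_lattice \<Rightarrow> 'a"
  assumes lin: "0 \<le> t \<Longrightarrow> bounded_linear (S t)"
    and semigroup: "0 \<le> s \<Longrightarrow> 0 \<le> t \<Longrightarrow> S (s + t) f = S s (S t f)"
    and eventually_pos: "0 \<le> f \<Longrightarrow> \<forall>\<^sub>F t in at_top. 0 \<le> S t f"
    and orbit_compact: "\<exists>K. compact K \<and> (\<lambda>t. S t f) ` {0..} \<subseteq> K"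
    and orbit_dense_ideal: "0 \<le> f \<Longrightarrow> f \<noteq> 0 \<Longrightarrow> \<exists>t\<ge>0. dense_ideal (S t f)"
begin

section \<open>Compact orbit hulls and a uniform bound\<close>

lemma commute: "0 \<le> s \<Longrightarrow> 0 \<le> t \<Longrightarrow> S s (S t f) = S t (S s f)"
  by (metis semigroup add.commute)

definition orbit_hull :: "'a \<Rightarrow> 'a set" where
  "orbit_hull f = (SOME K. compact K \<and> (\<lambda>t. S t f) ` {0..} \<subseteq> K)"

lemma orbit_hull:
  shows "compact (orbit_hull f)" and "0 \<le> t \<Longrightarrow> S t f \<in> orbit_hull f"
  using someI_ex[OF orbit_compact[of f]] by (auto simp: orbit_hull_def)

lemma bounded_semigroup: "\<exists>M>0. \<forall>t\<ge>0. \<forall>f. norm (S t f) \<le> M * norm f"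
proof -
  have "bounded ((\<lambda>t. S t f) ` {0..})" for f
    using orbit_hull by (auto intro: bounded_subset[OF compact_imp_bounded[OF orbit_hull(1)[of f]]])
  then show ?thesis
    using uniform_boundedness[of "{0..}" S] lin by (metis atLeast_iff)
qed

definition bound :: real where
  "bound = (SOME M. M > 0 \<and> (\<forall>t\<ge>0. \<forall>f. norm (S t f) \<le> M * norm f))"

lemma bound_pos: "bound > 0" and bound: "0 \<le> t \<Longrightarrow> norm (S t f) \<le> bound * norm f"
  using someI_ex[OF bounded_semigroup] by (auto simp: bound_def)

lemma tendsto_semigroup: "0 \<le> t \<Longrightarrow> (g \<longlongrightarrow> l) F \<Longrightarrow> ((\<lambda>x. S t (g x)) \<longlongrightarrow> S t l) F"
  by (rule bounded_linear.tendsto[OF lin])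

section \<open>Cluster points of the semigroup at infinity\<close>

text \<open>The omega-limit set of \<open>S\<close> in the strong operator topology, the closure
  being taken in the product topology.\<close>

definition limit_ops :: "('a \<Rightarrow> 'a) set" where
  "limit_ops = (\<Inter>s\<in>{0..}. closure (S ` {s..}))"

lemma closed_limit_ops: "closed limit_ops"
  unfolding limit_ops_def by (rule closed_INT) simp

lemma limit_opsI:
  assumes "F \<noteq> bot" "F \<le> at_top" "(S \<longlongrightarrow> R) F"
  shows "R \<in> limit_ops"
  unfolding limit_ops_def
proof
  fix s :: real assume "s \<in> {0..}"
  have "\<forall>\<^sub>F t in F. s \<le> t" using assms(2) eventually_ge_at_top filter_leD by blast
  then have "\<forall>\<^sub>F t in F. S t \<in> closure (S ` {s..})"
    by (rule eventually_mono) (auto intro: subsetD[OF closure_subset])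
  then show "R \<in> closure (S ` {s..})"
    by (rule Lim_in_closed_set[OF closed_closure _ assms(1) assms(3)])
qed

text \<open>The working form of membership: a property of \<open>S t f\<close> that holds for large
  \<open>t\<close> and survives limits passes to \<open>R f\<close>.\<close>

lemma limit_opsE:
  assumes "R \<in> limit_ops"
  obtains F where "F \<noteq> bot" "F \<le> at_top" "\<And>f. ((\<lambda>t. S t f) \<longlongrightarrow> R f) F"
proof -
  have "\<exists>\<^sub>F t in at_top. S t \<in> U" if U: "open U" "R \<in> U" for U
  proof (rule ccontr)
    assume "\<not> ?thesis"
    then obtain N where N: "\<And>t. t \<ge> N \<Longrightarrow> S t \<notin> U"
      by (auto simp: not_frequently eventually_at_top_linorder)
    have "R \<in> closure (S ` {max N 0..})" using assms unfolding limit_ops_def by auto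
    moreover have "U \<inter> closure (S ` {max N 0..}) = {}"
      using N U(1) by (subst open_Int_closure_eq_empty) auto
    ultimately show False using U by blast
  qed
  then obtain F where "F \<noteq> bot" "F \<le> at_top" "(S \<longlongrightarrow> R) F"
    by (rule tendsto_refine_filter)
  then show ?thesis using that by (simp add: tendsto_fun_iff)
qed

lemma limit_ops_bounded_linear:
  assumes "R \<in> limit_ops"
  shows "bounded_linear R" and "norm (R f) \<le> bound * norm f"
proof -
  obtain F where F: "F \<noteq> bot" "F \<le> at_top" "\<And>f. ((\<lambda>t. S t f) \<longlongrightarrow> R f) F"
    using limit_opsE[OF assms] by blast
  have ev: "\<forall>\<^sub>F t in F. 0 \<le> t" using F(2) eventually_ge_at_top filter_leD by blast
  have norm: "norm (R f) \<le> bound * norm f" for f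
    by (rule tendsto_upperbound[OF tendsto_norm[OF F(3)] _ F(1)])
      (auto intro: eventually_mono[OF ev] bound)
  have "R (f + g) = R f + R g" for f g
  proof (rule tendsto_unique[OF F(1) F(3)])
    have "\<forall>\<^sub>F t in F. S t f + S t g = S t (f + g)"
      using ev by eventually_elim (simp add: linear_add[OF bounded_linear.linear[OF lin]])
    then show "((\<lambda>t. S t (f + g)) \<longlongrightarrow> R f + R g) F"
      by (rule Lim_transform_eventually[OF tendsto_add[OF F(3) F(3)]])
  qed
  moreover have "R (c *\<^sub>R f) = c *\<^sub>R R f" for c f
  proof (rule tendsto_unique[OF F(1) F(3)])
    have "\<forall>\<^sub>F t in F. c *\<^sub>R S t f = S t (c *\<^sub>R f)"
      using ev by eventually_elim (simp add: linear_scale[OF bounded_linear.linear[OF lin]])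
    then show "((\<lambda>t. S t (c *\<^sub>R f)) \<longlongrightarrow> c *\<^sub>R R f) F"
      by (rule Lim_transform_eventually[OF tendsto_scaleR[OF tendsto_const F(3)]])
  qed
  ultimately show "bounded_linear R"
    by (rule bounded_linear_intro[where K = bound]) (use norm in \<open>simp add: mult.commute\<close>)
  show "norm (R f) \<le> bound * norm f" by (rule norm)
qed

text \<open>The time from which \<open>S t f\<close> is positive may depend on \<open>f\<close>,
  which does no harm since the limit is taken for each \<open>f\<close> separately.\<close>

lemma limit_ops_pos:
  assumes "R \<in> limit_ops" "0 \<le> f"
  shows "0 \<le> R f"
proof -
  obtain F where F: "F \<noteq> bot" "F \<le> at_top" "\<And>f. ((\<lambda>t. S t f) \<longlongrightarrow> R f) F"
    using limit_opsE[OF assms(1)] by blast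
  have "\<forall>\<^sub>F t in F. S t f \<in> {x. 0 \<le> x}"
    using filter_leD[OF F(2) eventually_pos[OF assms(2)]] by simp
  from Lim_in_closed_set[OF closed_positive_cone this F(1) F(3)] show ?thesis by simp
qed

lemma limit_ops_mono:
  assumes "R \<in> limit_ops" "f \<le> g"
  shows "R f \<le> R g"
  using assms(2)
  by (rule positive_op_mono[rotated 2])
    (simp_all add: assms(1) limit_ops_pos linear_diff[OF bounded_linear.linear[OF limit_ops_bounded_linear(1)]])

text \<open>With this, Tychonoff also applies to families of limit operators.\<close>

lemma limit_ops_orbit_hull:
  assumes "R \<in> limit_ops"
  shows "R f \<in> orbit_hull f"
proof -
  obtain F where F: "F \<noteq> bot" "F \<le> at_top" "\<And>f. ((\<lambda>t. S t f) \<longlongrightarrow> R f) F"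
    using limit_opsE[OF assms(1)] by blast
  have "\<forall>\<^sub>F t in F. S t f \<in> orbit_hull f"
    using filter_leD[OF F(2) eventually_ge_at_top[of 0]]
    by (rule eventually_mono) (rule orbit_hull)
  from Lim_in_closed_set[OF compact_imp_closed[OF orbit_hull(1)] this F(1) F(3)] show ?thesis .
qed

lemma limit_ops_commute_semigroup:
  assumes "R \<in> limit_ops" "0 \<le> s"
  shows "R (S s f) = S s (R f)"
proof -
  obtain F where F: "F \<noteq> bot" "F \<le> at_top" "\<And>f. ((\<lambda>t. S t f) \<longlongrightarrow> R f) F"
    using limit_opsE[OF assms(1)] by blast
  show ?thesis
  proof (rule tendsto_unique[OF F(1) F(3)])
    have "\<forall>\<^sub>F t in F. S s (S t f) = S t (S s f)"
      using filter_leD[OF F(2) eventually_ge_at_top[of 0]]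
      by (rule eventually_mono) (rule commute[OF assms(2)])
    then show "((\<lambda>t. S t (S s f)) \<longlongrightarrow> S s (R f)) F"
      by (rule Lim_transform_eventually[OF tendsto_semigroup[OF assms(2) F(3)]])
  qed
qed

lemma limit_ops_commute:
  assumes "R \<in> limit_ops" "Q \<in> limit_ops"
  shows "R (Q f) = Q (R f)"
proof -
  obtain F where F: "F \<noteq> bot" "F \<le> at_top" "\<And>f. ((\<lambda>t. S t f) \<longlongrightarrow> R f) F"
    using limit_opsE[OF assms(1)] by blast
  show ?thesis
  proof (rule tendsto_unique[OF F(1) F(3)])
    have "\<forall>\<^sub>F t in F. Q (S t f) = S t (Q f)"
      using filter_leD[OF F(2) eventually_ge_at_top[of 0]]
      by (rule eventually_mono) (rule limit_ops_commute_semigroup[OF assms(2)])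
    then show "((\<lambda>t. S t (Q f)) \<longlongrightarrow> Q (R f)) F"
      by (rule Lim_transform_eventually[OF
            bounded_linear.tendsto[OF limit_ops_bounded_linear(1)[OF assms(2)] F(3)]])
  qed
qed

lemma limit_ops_nonempty: "limit_ops \<noteq> {}"
proof -
  \<comment> \<open>Truncating the time keeps every value in the orbit hulls, whatever
    \<open>S\<close> is at negative times.\<close>
  define G where "G t = S (max t 0)" for t
  obtain F R where F: "F \<noteq> bot" "F \<le> at_top" "(G \<longlongrightarrow> R) F"
    by (rule tychonoff_refine_filter[where F = at_top and K = orbit_hull and f = G])
      (auto simp: G_def orbit_hull)
  have "\<forall>\<^sub>F t in F. G t = S t"
    using filter_leD[OF F(2) eventually_ge_at_top[of 0]]
    by (rule eventually_mono) (simp add: G_def max_absorb1)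
  then have "(S \<longlongrightarrow> R) F" by (rule Lim_transform_eventually[OF F(3)])
  then show ?thesis using limit_opsI F by blast
qed

section \<open>The group structure of the limit operators\<close>

text \<open>If \<open>S t\<close> tends to \<open>R\<close>, take a cluster point \<open>Q\<close>
  of the shifted operators \<open>S (t - s)\<close> and pass to the limit in
  \<open>S t f = S s (S (t - s) f)\<close>.\<close>

lemma limit_ops_divide_semigroup:
  assumes R: "R \<in> limit_ops" and s: "0 \<le> s"
  shows "\<exists>Q\<in>limit_ops. \<forall>f. S s (Q f) = R f"
proof -
  obtain F where F: "F \<noteq> bot" "F \<le> at_top" "\<And>f. ((\<lambda>t. S t f) \<longlongrightarrow> R f) F"
    using limit_opsE[OF R] by blast
  have ev: "\<forall>\<^sub>F t in F. s \<le> t" by (rule filter_leD[OF F(2) eventually_ge_at_top])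
  obtain F' Q where F': "F' \<noteq> bot" "F' \<le> F" "((\<lambda>t. S (t - s)) \<longlongrightarrow> Q) F'"
  proof (rule tychonoff_refine_filter[where F = F and K = orbit_hull and f = "\<lambda>t. S (t - s)"])
    show "\<forall>\<^sub>F t in F. \<forall>f. S (t - s) f \<in> orbit_hull f"
      using ev by (rule eventually_mono) (auto intro: orbit_hull)
  qed (use F orbit_hull in auto)
  have Q: "((\<lambda>t. S (t - s) f) \<longlongrightarrow> Q f) F'" for f using F'(3) by (simp add: tendsto_fun_iff)
  \<comment> \<open>Along the shifted filter, which still tends to infinity, \<open>Q\<close> is a
    limit of \<open>S\<close> itself.\<close>
  let ?G = "filtermap (\<lambda>t. t - s) F'"
  have "LIM t F'. - s + t :> at_top"
    using F'(2) F(2)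
    by (intro filterlim_tendsto_add_at_top[OF tendsto_const]) (simp add: filterlim_def filtermap_ident)
  then have "?G \<le> at_top" by (simp add: filterlim_def)
  moreover have "?G \<noteq> bot" using F'(1) by (simp add: filtermap_bot_iff)
  moreover have "(S \<longlongrightarrow> Q) ?G" using F'(3) by (simp add: filterlim_filtermap)
  ultimately have "Q \<in> limit_ops" by (intro limit_opsI)
  moreover have "S s (Q f) = R f" for f
  proof (rule tendsto_unique[OF F'(1)])
    show "((\<lambda>t. S s (S (t - s) f)) \<longlongrightarrow> S s (Q f)) F'"
      by (rule tendsto_semigroup[OF s Q])
    have "\<forall>\<^sub>F t in F'. S t f = S s (S (t - s) f)"
      using filter_leD[OF F'(2) ev] semigroup[OF s]
      by (auto elim!: eventually_mono) (metis add.commute diff_add_cancel diff_ge_0_iff_ge)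
    then show "((\<lambda>t. S s (S (t - s) f)) \<longlongrightarrow> R f) F'"
      by (rule Lim_transform_eventually[OF tendsto_mono[OF F'(2) F(3)]])
  qed
  ultimately show ?thesis by blast
qed

text \<open>Solvability of this equation makes the commutative semigroup of limit operators a group.
  The quotient \<open>V\<close> is a cluster point of quotients \<open>W t\<close> of
  \<open>Q\<close> by \<open>S t\<close>, as \<open>S t\<close> tends to \<open>R\<close>.\<close>

lemma limit_ops_divide:
  assumes R: "R \<in> limit_ops" and Q: "Q \<in> limit_ops"
  shows "\<exists>V\<in>limit_ops. \<forall>f. V (R f) = Q f"
proof -
  obtain F where F: "F \<noteq> bot" "F \<le> at_top" "\<And>f. ((\<lambda>t. S t f) \<longlongrightarrow> R f) F"
    using limit_opsE[OF R] by blast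
  have ev: "\<forall>\<^sub>F t in F. 0 \<le> t" by (rule filter_leD[OF F(2) eventually_ge_at_top])
  obtain W where W: "\<And>t. t \<ge> 0 \<Longrightarrow> W t \<in> limit_ops" "\<And>t f. t \<ge> 0 \<Longrightarrow> S t (W t f) = Q f"
    using limit_ops_divide_semigroup[OF Q] by metis
  obtain F' V where F': "F' \<noteq> bot" "F' \<le> F" "(W \<longlongrightarrow> V) F'"
  proof (rule tychonoff_refine_filter[where F = F and K = orbit_hull and f = W])
    show "\<forall>\<^sub>F t in F. \<forall>f. W t f \<in> orbit_hull f"
      using ev by (rule eventually_mono) (auto intro: limit_ops_orbit_hull W)
  qed (use F orbit_hull in auto)
  have ev': "\<forall>\<^sub>F t in F'. 0 \<le> t" by (rule filter_leD[OF F'(2) ev])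
  have lim: "((\<lambda>t. W t f) \<longlongrightarrow> V f) F'" for f using F'(3) by (simp add: tendsto_fun_iff)
  have V: "V \<in> limit_ops"
    by (rule Lim_in_closed_set[OF closed_limit_ops _ F'(1) F'(3)])
      (use ev' W in \<open>auto elim: eventually_mono\<close>)
  have "R (V f) = Q f" for f
  proof (rule tendsto_unique[OF F'(1)])
    show "((\<lambda>t. S t (V f)) \<longlongrightarrow> R (V f)) F'" by (rule tendsto_mono[OF F'(2) F(3)])
    \<comment> \<open>Both factors of \<open>S t (W t f)\<close> vary, and strong limits of factors
      need not multiply; here the uniform bound controls the error
      \<open>S t (V f - W t f)\<close>.\<close>
    have "((\<lambda>t. bound * norm (V f - W t f)) \<longlongrightarrow> bound * norm (V f - V f)) F'"
      by (intro tendsto_intros lim)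
    then have "((\<lambda>t. bound * norm (V f - W t f)) \<longlongrightarrow> 0) F'" by simp
    moreover have "\<forall>\<^sub>F t in F'. norm (S t (V f) - Q f) \<le> bound * norm (V f - W t f)"
      using ev'
    proof eventually_elim
      case (elim t)
      then show ?case
        using bound[of t "V f - W t f"] W(2)[of t f]
        by (simp add: linear_diff[OF bounded_linear.linear[OF lin]])
    qed
    ultimately have "((\<lambda>t. S t (V f) - Q f) \<longlongrightarrow> 0) F'"
      by (rule Lim_null_comparison[rotated])
    then show "((\<lambda>t. S t (V f)) \<longlongrightarrow> Q f) F'" by (simp add: LIM_zero_iff)
  qed
  then show ?thesis using V limit_ops_commute[OF R V] by metis
qed

text \<open>Dividing \<open>R\<close> by itself gives \<open>P\<close>. Any \<open>Q\<close> is
  \<open>V\<close> after \<open>R\<close>, and since \<open>P\<close> commutes with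
  \<open>V\<close>, it fixes the values of \<open>Q\<close> as well.\<close>

lemma limit_ops_unit: "\<exists>P\<in>limit_ops. \<forall>R\<in>limit_ops. \<forall>f. P (R f) = R f"
proof -
  obtain R where R: "R \<in> limit_ops" using limit_ops_nonempty by blast
  obtain P where P: "P \<in> limit_ops" "\<And>f. P (R f) = R f" using limit_ops_divide[OF R R] by blast
  have "P (Q f) = Q f" if Q: "Q \<in> limit_ops" for Q f
  proof -
    obtain V where V: "V \<in> limit_ops" "\<And>f. V (R f) = Q f" using limit_ops_divide[OF R Q] by blast
    show ?thesis using P(2) V(2) limit_ops_commute[OF P(1) V(1)] by metis
  qed
  then show ?thesis using P(1) by blast
qed

section \<open>The unit as a positive projection\<close>

definition proj :: "'a \<Rightarrow> 'a" where
  "proj = (SOME P. P \<in> limit_ops \<and> (\<forall>R\<in>limit_ops. \<forall>f. P (R f) = R f))"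

lemma proj_limit_ops: "proj \<in> limit_ops"
  and proj_unit: "R \<in> limit_ops \<Longrightarrow> proj (R f) = R f"
  using someI_ex[of "\<lambda>P. P \<in> limit_ops \<and> (\<forall>R\<in>limit_ops. \<forall>f. P (R f) = R f)"] limit_ops_unit
  by (auto simp: proj_def)

sublocale proj: bounded_linear proj
  by (rule limit_ops_bounded_linear[OF proj_limit_ops])

lemmas proj_idem = proj_unit[OF proj_limit_ops]
lemmas proj_pos = limit_ops_pos[OF proj_limit_ops]
lemmas proj_mono = limit_ops_mono[OF proj_limit_ops]
lemmas proj_commute = limit_ops_commute_semigroup[OF proj_limit_ops]

text \<open>If \<open>proj\<close> kills \<open>f\<close>, it also kills \<open>S t f\<close>, and a
  positive operator that vanishes at a quasi-interior point is zero. So a nonzero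
  \<open>proj\<close> is strictly positive.\<close>

lemma proj_strictly_pos:
  assumes "0 \<le> f" "f \<noteq> 0" "proj f = 0"
  shows "proj g = 0"
proof -
  obtain t where t: "t \<ge> 0" "dense_ideal (S t f)" using orbit_dense_ideal assms by blast
  have "proj (S t f) = 0"
    using proj_commute[OF t(1)] assms(3) linear_0[OF bounded_linear.linear[OF lin[OF t(1)]]] by simp
  show ?thesis
    by (rule dense_ideal_positive_op[OF t(2) proj.bounded_linear_axioms _ \<open>proj (S t f) = 0\<close>])
      (rule proj_pos)
qed

text \<open>\<open>S t\<close> need not be positive, but on the range of \<open>proj\<close> the
  vector \<open>S t f\<close> equals \<open>proj (S t f)\<close>, a limit of vectors
  \<open>S (s + t) f\<close> with \<open>s\<close> large.\<close>

lemma semigroup_pos_fix: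
  assumes "0 \<le> t" "proj f = f" "0 \<le> f"
  shows "0 \<le> S t f"
proof -
  obtain F where F: "F \<noteq> bot" "F \<le> at_top" "\<And>f. ((\<lambda>t. S t f) \<longlongrightarrow> proj f) F"
    using limit_opsE[OF proj_limit_ops] by blast
  have lim: "((\<lambda>s. S s (S t f)) \<longlongrightarrow> S t f) F"
    using F(3)[of "S t f"] proj_commute[OF assms(1)] assms(2) by simp
  have ev: "\<forall>\<^sub>F s in at_top. S s (S t f) \<in> {x. 0 \<le> x}"
  proof -
    have "\<forall>\<^sub>F s in at_top. 0 \<le> S (s + t) f"
      using eventually_pos[OF assms(3)]
      by (auto simp: eventually_at_top_linorder) (metis add_increasing2 assms(1))
    then show ?thesis using eventually_ge_at_top[of 0]
      by eventually_elim (simp add: semigroup assms(1))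
  qed
  have "S t f \<in> {x. 0 \<le> x}"
    by (rule Lim_in_closed_set[OF closed_positive_cone filter_leD[OF F(2) ev] F(1) lim])
  then show ?thesis by simp
qed

section \<open>The range of the projection is a line of fixed points\<close>

text \<open>Split \<open>f\<close> as \<open>a - b\<close> with \<open>a\<close>, \<open>b\<close>
  positive and disjoint within the range. If \<open>a \<noteq> 0\<close>, some \<open>S t a\<close>
  is quasi-interior. As \<open>S t\<close> is an order isomorphism of the range,
  \<open>S t a\<close> and \<open>S t b\<close> are still disjoint there, and strict positivity of
  \<open>proj\<close> makes them disjoint in the full lattice, so \<open>S t b = 0\<close>.\<close>

lemma range_proj_comparable:
  assumes f: "proj f = f"
  shows "0 \<le> f \<or> f \<le> 0"
proof (cases "\<forall>g. proj g = 0")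
  case True
  then show ?thesis using f by simp
next
  case False
  then have spos: "0 \<le> g \<Longrightarrow> proj g = 0 \<Longrightarrow> g = 0" for g using proj_strictly_pos by blast
  define a where "a = proj (sup f 0)"
  define b where "b = a - f"
  have pa: "proj a = a" unfolding a_def by (rule proj_idem)
  have pb: "proj b = b" unfolding b_def by (simp add: proj.diff pa f)
  have a0: "0 \<le> a" unfolding a_def by (rule proj_pos) simp
  have b0: "0 \<le> b"
    unfolding b_def a_def using proj_mono[of f "sup f 0"] f by simp
  \<comment> \<open>\<open>a\<close> and \<open>b\<close> are the positive and the negative part of \<open>f\<close> in the order of the range.\<close>
  have disj: "c = 0" if c: "proj c = c" "0 \<le> c" "c \<le> a" "c \<le> b" for c
  proof -
    \<comment> \<open>Removing \<open>c\<close> from \<open>a\<close> leaves an upper bound of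
      \<open>f\<close> and \<open>0\<close> inside the range, but \<open>a\<close> is the least such
      bound.\<close>
    have "f \<le> a - c" "0 \<le> a - c"
      using c(3,4) unfolding b_def by (simp_all add: algebra_simps)
    then have "sup f 0 \<le> a - c" by simp
    then have "a \<le> proj (a - c)" unfolding a_def by (rule proj_mono)
    then show ?thesis using c by (simp add: proj.diff pa)
  qed
  show ?thesis
  proof (cases "a = 0")
    case True
    then show ?thesis using b0 unfolding b_def by simp
  next
    case False
    obtain t where t: "t \<ge> 0" "dense_ideal (S t a)" using orbit_dense_ideal[OF a0 False] by blast
    interpret St: bounded_linear "S t" by (rule lin[OF t(1)])
    \<comment> \<open>\<open>Q\<close> inverts \<open>S t\<close> on the range and, being a limit
      operator, is positive.\<close>
    obtain Q where Q: "Q \<in> limit_ops" "\<And>g. S t (Q g) = proj g"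
      using limit_ops_divide_semigroup[OF proj_limit_ops t(1)] by blast
    have QS: "Q (S t g) = proj g" for g
      using Q limit_ops_commute_semigroup[OF Q(1) t(1)] by simp
    have Sa: "0 \<le> S t a" and Sb: "0 \<le> S t b"
      using semigroup_pos_fix[OF t(1)] pa pb a0 b0 by auto
    \<comment> \<open>This is the infimum in the order of the range. Pulled back by \<open>Q\<close>
      it lies below \<open>a\<close> and \<open>b\<close>, so it vanishes; strict positivity then
      makes the lattice infimum itself zero.\<close>
    define c where "c = proj (inf (S t a) (S t b))"
    have c0: "0 \<le> c" unfolding c_def by (rule proj_pos) (simp add: Sa Sb)
    have "c \<le> S t a" "c \<le> S t b"
      unfolding c_def using proj_mono[OF inf_le1, of "S t a" "S t b"]
        proj_mono[OF inf_le2, of "S t a" "S t b"] by (simp_all add: proj_commute t(1) pa pb)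
    then have "Q c \<le> a" "Q c \<le> b"
      using limit_ops_mono[OF Q(1)] QS pa pb by metis+
    then have "Q c = 0" using disj[OF proj_unit[OF Q(1)] limit_ops_pos[OF Q(1) c0]] by simp
    then have "proj c = 0" using Q(2)[of c] by (simp add: St.zero)
    then have "c = 0" by (simp add: c_def proj_idem)
    then have "inf (S t a) (S t b) = 0" unfolding c_def by (rule spos[rotated]) (simp add: Sa Sb)
    then have "S t b = 0" by (rule dense_ideal_disjoint[OF t(2) Sa Sb])
    then have "b = 0"
      using QS[of b] pb linear_0[OF bounded_linear.linear[OF limit_ops_bounded_linear(1)[OF Q(1)]]]
      by simp
    then show ?thesis using a0 unfolding b_def by simp
  qed
qed

lemma range_proj_multiple:
  assumes "proj u = u" "0 \<le> u" "u \<noteq> 0" "proj f = f"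
  shows "\<exists>c. f = c *\<^sub>R u"
proof (rule comparable_imp_multiple[OF assms(2,3)])
  fix c
  have "proj (f - c *\<^sub>R u) = f - c *\<^sub>R u" using assms by (simp add: proj.diff proj.scaleR)
  from range_proj_comparable[OF this] show "f \<le> c *\<^sub>R u \<or> c *\<^sub>R u \<le> f" by auto
qed

text \<open>On a one-dimensional range \<open>S t\<close> multiplies by some
  \<open>c \<ge> 0\<close>. Its powers are bounded, and so are those of its inverse, which leaves
  only \<open>c = 1\<close>.\<close>

lemma semigroup_fix:
  assumes f: "proj f = f" and t: "0 \<le> t"
  shows "S t f = f"
proof -
  have *: "S t u = u" if u: "proj u = u" "0 \<le> u" "u \<noteq> 0" for u
  proof -
    have "proj (S t u) = S t u" using u t by (simp add: proj_commute)
    then obtain c where c: "S t u = c *\<^sub>R u" using range_proj_multiple u by blast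
    have c0: "c \<ge> 0"
    proof (rule ccontr)
      assume "\<not> c \<ge> 0"
      moreover have "0 \<le> c *\<^sub>R u" using semigroup_pos_fix[OF t u(1,2)] c by simp
      ultimately have "u \<le> 0"
        using scaleR_left_mono[of 0 "c *\<^sub>R u" "- inverse c"] by simp
      then show False using u by simp
    qed
    have n: "0 \<le> real n * t" for n using t by simp
    have pow: "S (real n * t) u = (c ^ n) *\<^sub>R u" for n
    proof (induction n)
      case 0
      \<comment> \<open>\<open>S 0\<close> is idempotent by the semigroup law and has
        \<open>proj u\<close> in its range, so it fixes \<open>u\<close>.\<close>
      have "S 0 u = u"
      proof -
        have "proj u = S 0 (proj u)"
        proof -
          obtain Q where "Q \<in> limit_ops" "\<And>g. S 0 (Q g) = proj g"
            using limit_ops_divide_semigroup[OF proj_limit_ops order_refl] by blast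
          then show ?thesis using semigroup[OF order_refl order_refl] by (metis add_0)
        qed
        then show ?thesis using u by simp
      qed
      then show ?case by simp
    next
      case (Suc n)
      have "S (real (Suc n) * t) u = S t (S (real n * t) u)"
        using semigroup[OF t n, of n u] by (simp add: algebra_simps)
      also have "\<dots> = c ^ n *\<^sub>R S t u"
        unfolding Suc by (rule linear_scale[OF bounded_linear.linear[OF lin[OF t]]])
      finally show ?case by (simp add: c mult.commute)
    qed
    have le: "c ^ n \<le> bound" for n
      using bound[OF n, of n u] u(3) c0 by (simp add: pow)
    \<comment> \<open>The inverse of \<open>S (real n * t)\<close> on the range is a limit operator,
      hence subject to the same \<open>bound\<close>.\<close>
    have ge: "1 \<le> bound * c ^ n" for n
    proof -
      obtain Q where Q: "Q \<in> limit_ops" "\<And>g. S (real n * t) (Q g) = proj g"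
        using limit_ops_divide_semigroup[OF proj_limit_ops n] by blast
      have "u = Q (c ^ n *\<^sub>R u)"
        using Q(2)[of u] u limit_ops_commute_semigroup[OF Q(1) n] pow by metis
      then have "norm u \<le> bound * norm (c ^ n *\<^sub>R u)"
        using limit_ops_bounded_linear(2)[OF Q(1), of "c ^ n *\<^sub>R u"] by simp
      then have "1 * norm u \<le> (bound * c ^ n) * norm u" using c0 by simp
      then show ?thesis using u(3) by (simp only: mult_le_cancel_right) simp
    qed
    have "c \<le> 1"
    proof (rule ccontr)
      assume "\<not> c \<le> 1"
      then obtain n where "bound < c ^ n" using real_arch_pow[of c bound] by auto
      then show False using le[of n] by simp
    qed
    moreover have "c \<ge> 1"
    proof (rule ccontr)
      assume "\<not> c \<ge> 1"
      then obtain n where "c ^ n < 1 / bound"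
        using real_arch_pow_inv[of "1 / bound" c] bound_pos by auto
      then show False using ge[of n] bound_pos by (simp add: field_simps)
    qed
    ultimately show ?thesis using c by simp
  qed
  consider "f = 0" | "0 \<le> f" "f \<noteq> 0" | "0 \<le> - f" "- f \<noteq> 0"
    using range_proj_comparable[OF f] by fastforce
  then show ?thesis
  proof cases
    case 1
    then show ?thesis using linear_0[OF bounded_linear.linear[OF lin[OF t]]] by simp
  next
    case 2
    then show ?thesis using * f by blast
  next
    case 3
    then have "S t (- f) = - f" using f by (intro *) (simp_all add: proj.neg)
    then show ?thesis using linear_neg[OF bounded_linear.linear[OF lin[OF t]]] by simp
  qed
qed

lemma semigroup_proj: "0 \<le> t \<Longrightarrow> S t (proj f) = proj f"
  by (rule semigroup_fix[OF proj_idem])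

section \<open>Convergence and the rank-one form of the limit\<close>

text \<open>A cluster point supplies just one time \<open>s\<close> at which the orbit is close to
  \<open>proj f\<close>. As \<open>S (t - s)\<close> fixes \<open>proj f\<close> and is uniformly
  bounded, the orbit stays close for all \<open>t \<ge> s\<close>.\<close>

lemma tendsto_proj: "((\<lambda>t. S t f) \<longlongrightarrow> proj f) at_top"
proof (rule tendstoI)
  fix e :: real assume e: "e > 0"
  obtain F where F: "F \<noteq> bot" "F \<le> at_top" "\<And>f. ((\<lambda>t. S t f) \<longlongrightarrow> proj f) F"
    using limit_opsE[OF proj_limit_ops] by blast
  have "\<forall>\<^sub>F t in F. dist (S t f) (proj f) < e / bound \<and> 0 \<le> t"
    using tendstoD[OF F(3), of "e / bound" f] e bound_pos
      filter_leD[OF F(2) eventually_ge_at_top[of 0]] by (auto intro: eventually_conj)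
  then obtain s where s: "dist (S s f) (proj f) < e / bound" "0 \<le> s"
    using eventually_happens'[OF F(1)] by blast
  show "\<forall>\<^sub>F t in at_top. dist (S t f) (proj f) < e"
    using eventually_ge_at_top[of s]
  proof eventually_elim
    case (elim t)
    then have t: "0 \<le> t - s" by simp
    have "S t f - proj f = S (t - s) (S s f - proj f)"
      using semigroup[OF t s(2), of f]
      by (simp add: linear_diff[OF bounded_linear.linear[OF lin[OF t]]] semigroup_proj[OF t])
    then have "norm (S t f - proj f) \<le> bound * norm (S s f - proj f)"
      using bound[OF t] by metis
    also have "\<dots> < e" using s(1) bound_pos by (simp add: dist_norm field_simps)
    finally show ?case by (simp add: dist_norm)
  qed
qed


text \<open>\<open>c\<close> is the coordinate functional of \<open>proj\<close> with respect to a
  positive vector \<open>u\<close> spanning the range; its properties are read off from those of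
  \<open>proj\<close>.\<close>

lemma proj_rank_one:
  assumes "proj g \<noteq> 0"
  obtains u c where "0 \<le> u" "u \<noteq> 0" "dense_ideal u" "\<forall>t\<ge>0. S t u = u"
    "bounded_linear c" "c u = (1::real)" "\<forall>f. proj f = c f *\<^sub>R u"
    "\<forall>t\<ge>0. \<forall>f. c (S t f) = c f" "\<forall>f. 0 \<le> f \<and> f \<noteq> 0 \<longrightarrow> 0 < c f"
proof -
  define u where "u = (if 0 \<le> proj g then proj g else - proj g)"
  have u: "proj u = u" "0 \<le> u" "u \<noteq> 0"
    using range_proj_comparable[OF proj_idem, of g] assms
    by (auto simp: u_def proj_idem proj.neg)
  have fix_u: "S t u = u" if "0 \<le> t" for t by (rule semigroup_fix[OF u(1) that])
  \<comment> \<open>The orbit of \<open>u\<close> is constant, so the quasi-interior point on it is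
    \<open>u\<close> itself.\<close>
  have dense: "dense_ideal u" using orbit_dense_ideal[OF u(2,3)] fix_u by auto
  obtain c where c: "\<And>f. proj f = c f *\<^sub>R u"
    using range_proj_multiple[OF u proj_idem] by metis
  have eqI: "a = b" if "a *\<^sub>R u = b *\<^sub>R u" for a b using that u(3) by simp
  have lin_c: "bounded_linear c"
  proof (rule bounded_linear_intro)
    show "c (f + h) = c f + c h" for f h
      by (rule eqI) (simp add: c[symmetric] proj.add scaleR_add_left)
    show "c (r *\<^sub>R f) = r *\<^sub>R c f" for r f
    proof (rule eqI)
      show "c (r *\<^sub>R f) *\<^sub>R u = (r *\<^sub>R c f) *\<^sub>R u"
        by (simp only: c[symmetric] proj.scaleR real_scaleR_def scaleR_scaleR[symmetric])
    qed
    show "norm (c f) \<le> norm f * (bound / norm u)" for f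
      using limit_ops_bounded_linear(2)[OF proj_limit_ops, of f] u(3)
      by (simp add: c field_simps)
  qed
  have "c u = 1" by (rule eqI) (simp add: c[symmetric] u(1))
  moreover have "c (S t f) = c f" if "0 \<le> t" for t f
    by (rule eqI) (simp add: c[symmetric] proj_commute semigroup_proj that)
  moreover have "0 < c f" if f: "0 \<le> f" "f \<noteq> 0" for f
  proof -
    have "0 \<le> c f *\<^sub>R u" using proj_pos[OF f(1)] by (simp add: c)
    moreover have "proj f \<noteq> 0" using proj_strictly_pos[OF f] assms by blast
    ultimately have *: "c f \<noteq> 0" "0 \<le> c f *\<^sub>R u" by (auto simp: c)
    have "\<not> c f < 0"
    proof
      assume "c f < 0"
      then have "u \<le> 0" using scaleR_left_mono[OF *(2), of "- inverse (c f)"] by simp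
      then show False using u by simp
    qed
    then show ?thesis using *(1) by simp
  qed
  ultimately show ?thesis
    using u(2,3) dense fix_u lin_c c by (intro that[of u c] allI impI) blast+
qed

end

subsection \<open>Complexification\<close>

lemma Cplx_linear_combination: "z = Cplx (re z) 0 + cscale \<i> (Cplx (im z) 0)"
  by (cases z) (simp add: complexification_ops cscale_def)

lemma bounded_linear_Cplx_real: "bounded_linear (\<lambda>x. Cplx x 0)"
  by (rule bounded_linear_intro[where K = 1])
    (simp_all add: complexification_ops norm_complexification_def modulus_real norm_abs_lattice)

lemma tendsto_Cplx:
  assumes "(f \<longlongrightarrow> x) F" "(g \<longlongrightarrow> y) F"
  shows "((\<lambda>t. Cplx (f t) (g t)) \<longlongrightarrow> Cplx x y) F"
proof -
  have "((\<lambda>t. norm (f t - x) + norm (g t - y)) \<longlongrightarrow> 0) F"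
    using tendsto_add[OF tendsto_norm_zero[OF LIM_zero[OF assms(1)]]
        tendsto_norm_zero[OF LIM_zero[OF assms(2)]]] by simp
  moreover have "norm (Cplx (f t) (g t) - Cplx x y) \<le> norm (f t - x) + norm (g t - y)" for t
    using norm_complexification_le[of "Cplx (f t) (g t) - Cplx x y"] by simp
  ultimately have "((\<lambda>t. Cplx (f t) (g t) - Cplx x y) \<longlongrightarrow> 0) F"
    by (rule Lim_null_comparison[OF always_eventually[OF allI], rotated])
  then show ?thesis by (rule LIM_zero_cancel)
qed

text \<open>Taking real parts of approximants gives one direction. For the other, the real and
  imaginary parts are approximated separately, and \<open>modulus_le\<close> keeps the combined
  vector in the ideal with constant \<open>c + d\<close>.\<close>

lemma quasi_interior_Cplx_iff: "quasi_interior (Cplx u 0) \<longleftrightarrow> 0 \<le> u \<and> dense_ideal u"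
proof
  assume *: "quasi_interior (Cplx u 0)"
  have "x \<in> closure {g. \<exists>c>0. \<bar>g\<bar> \<le> c *\<^sub>R u}" for x
    unfolding closure_approachable
  proof (intro allI impI)
    fix e :: real assume "e > 0"
    moreover have "Cplx x 0 \<in> closure (principal_ideal (Cplx u 0))"
      using * by (simp add: quasi_interior_def)
    ultimately obtain z where z: "z \<in> principal_ideal (Cplx u 0)" "dist z (Cplx x 0) < e"
      unfolding closure_approachable by blast
    then obtain c where "c > 0" "modulus (re z) (im z) \<le> c *\<^sub>R u"
      by (auto simp: principal_ideal_def abs_complexification_def less_eq_complexification_def)
    then have "\<exists>c>0. \<bar>re z\<bar> \<le> c *\<^sub>R u" using abs_le_modulus1 order_trans by blast
    moreover have "dist (re z) x < e"
      using norm_re_le[of "z - Cplx x 0"] z(2) by (simp add: dist_norm)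
    ultimately show "\<exists>y\<in>{g. \<exists>c>0. \<bar>g\<bar> \<le> c *\<^sub>R u}. dist y x < e" by blast
  qed
  then show "0 \<le> u \<and> dense_ideal u"
    using * by (auto simp: quasi_interior_def dense_ideal_def less_eq_complexification_def)
next
  assume *: "0 \<le> u \<and> dense_ideal u"
  have "z \<in> closure (principal_ideal (Cplx u 0))" for z
    unfolding closure_approachable
  proof (intro allI impI)
    fix e :: real assume e: "e > 0"
    have approx: "\<exists>g c. c > 0 \<and> \<bar>g\<bar> \<le> c *\<^sub>R u \<and> dist g x < e / 2" for x
    proof -
      have "x \<in> closure {g. \<exists>c>0. \<bar>g\<bar> \<le> c *\<^sub>R u}" using * by (simp add: dense_ideal_def)
      then show ?thesis using half_gt_zero[OF e] unfolding closure_approachable by blast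
    qed
    obtain g c where g: "c > 0" "\<bar>g\<bar> \<le> c *\<^sub>R u" "dist g (re z) < e / 2" using approx by blast
    obtain h d where h: "d > 0" "\<bar>h\<bar> \<le> d *\<^sub>R u" "dist h (im z) < e / 2" using approx by blast
    have "modulus g h \<le> (c + d) *\<^sub>R u"
      using order_trans[OF modulus_le add_mono[OF g(2) h(2)]] by (simp add: scaleR_add_left)
    then have "Cplx g h \<in> principal_ideal (Cplx u 0)"
      unfolding principal_ideal_def abs_complexification_def less_eq_complexification_def
      using add_pos_pos[OF g(1) h(1)] by auto
    moreover have "dist (Cplx g h) z < e"
      using norm_complexification_le[of "Cplx g h - z"] g(3) h(3) by (simp add: dist_norm)
    ultimately show "\<exists>y\<in>principal_ideal (Cplx u 0). dist y z < e" by blast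
  qed
  then show "quasi_interior (Cplx u 0)"
    using * by (auto simp: quasi_interior_def less_eq_complexification_def)
qed

lemma cplx_pos_iff: "0 \<le> z \<longleftrightarrow> (\<exists>x\<ge>0. z = Cplx x 0)"
  by (cases z) (auto simp: less_eq_complexification_def)

text \<open>The range \<open>{0}\<close> has dimension \<open>0\<close>; this makes the two
  alternatives of the theorem exclusive.\<close>

lemma tensor_op_zero_not_rank_one:
  assumes "tensor_op u \<phi> = (\<lambda>_. 0)"
  shows "\<not> rank_one_projection (tensor_op u \<phi>)"
proof -
  have "complexification.dim {0 :: 'a complexification} = 0"
    by (rule complexification.dim_unique[of "{}"]) (auto simp: complexification.span_empty
        complexification.independent_empty)
  then show ?thesis using assms by (simp add: rank_one_projection_def)
qed

text \<open>The normalization \<open>\<phi> u = 1\<close> gives idempotence and forces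
  \<open>u \<noteq> 0\<close>, so that the range is the complex line through
  \<open>u\<close>.\<close>

lemma rank_one_projection_tensor_op:
  assumes \<phi>: "\<phi> \<in> dual_space" and u: "\<phi> u = 1"
  shows "rank_one_projection (tensor_op u \<phi>)"
proof -
  have lin: "bounded_linear \<phi>" and hom: "\<And>c f. \<phi> (cscale c f) = c * \<phi> f"
    using \<phi> by (auto simp: dual_space_def)
  interpret \<phi>: bounded_linear \<phi> by (rule lin)
  obtain K where K: "\<And>f. norm (\<phi> f) \<le> norm f * K" using \<phi>.bounded by blast
  have "bounded_linear (\<lambda>f. cscale (\<phi> f) u)"
  proof (rule bounded_linear_intro)
    show "cscale (\<phi> (f + g)) u = cscale (\<phi> f) u + cscale (\<phi> g) u" for f g
      by (simp add: \<phi>.add complexification.scale_left_distrib)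
    show "cscale (\<phi> (r *\<^sub>R f)) u = r *\<^sub>R cscale (\<phi> f) u" for r f
      by (simp only: \<phi>.scaleR scaleR_conv_of_real[of r "\<phi> f"] cscale_of_real
          complexification.scale_scale[symmetric])
    show "norm (cscale (\<phi> f) u) \<le> norm f * (K * norm u)" for f
      using mult_right_mono[OF K[of f] norm_ge_zero[of u]] by (simp add: norm_cscale)
  qed
  then have "bounded_op (tensor_op u \<phi>)"
    unfolding bounded_op_def tensor_op_def by (simp add: hom)
  moreover have "tensor_op u \<phi> \<circ> tensor_op u \<phi> = tensor_op u \<phi>"
    by (auto simp: tensor_op_def hom u)
  moreover have "complexification.dim (range (tensor_op u \<phi>)) = 1"
  proof (rule complexification.dim_unique[of "{u}"])
    have "u = tensor_op u \<phi> u" by (simp add: tensor_op_def u)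
    then show "{u} \<subseteq> range (tensor_op u \<phi>)" by blast
    show "range (tensor_op u \<phi>) \<subseteq> complexification.span {u}"
      by (auto simp: tensor_op_def complexification.span_singleton)
    have "u \<noteq> 0" using u \<phi>.zero by auto
    then show "complexification.independent {u}" by simp
  qed simp
  ultimately show ?thesis by (simp add: rank_one_projection_def)
qed

text \<open>A real complex-linear operator is determined by its restriction to the real part and
  acts on real and imaginary parts separately, so all hypotheses transfer to
  \<open>S\<close>.\<close>

lemma real_semigroup_real_part:
  fixes T :: "real \<Rightarrow> 'a::banach_lattice complexification \<Rightarrow> 'a complexification"
  assumes C0: "C0_semigroup T"
    and real: "\<forall>t\<ge>0. real_op (T t)"
    and pos: "individually_eventually_positive T"
    and qi: "\<forall>f. 0 \<le> f \<and> f \<noteq> 0 \<longrightarrow> (\<exists>t\<ge>0. quasi_interior (T t f))"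
    and cpt: "relatively_compact_orbits T"
  obtains S where "real_semigroup S" "\<And>t z. 0 \<le> t \<Longrightarrow> T t z = Cplx (S t (re z)) (S t (im z))"
proof -
  define S where "S t x = re (T t (Cplx x 0))" for t x
  have op: "bounded_op (T t)" if "0 \<le> t" for t using C0 that by (simp add: C0_semigroup_def)
  have T_real: "T t (Cplx x 0) = Cplx (S t x) 0" if "0 \<le> t" for t x
  proof -
    have "T t (Cplx x 0) \<in> real_part"
      using real that by (auto simp: real_op_def real_part_def image_subset_iff)
    then show ?thesis by (auto simp: S_def real_part_def complexification.expand)
  qed
  have T_eq: "T t z = Cplx (S t (re z)) (S t (im z))" if "0 \<le> t" for t z
  proof -
    have "linear (T t)" "\<And>c f. T t (cscale c f) = cscale c (T t f)"
      using op[OF that] by (auto simp: bounded_op_def bounded_linear.linear)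
    then have "T t z = T t (Cplx (re z) 0) + cscale \<i> (T t (Cplx (im z) 0))"
      by (subst Cplx_linear_combination) (simp add: linear_add)
    then show ?thesis by (simp add: T_real that complexification_ops cscale_def)
  qed
  have "real_semigroup S"
  proof (rule real_semigroup.intro)
    show "bounded_linear (S t)" if "0 \<le> t" for t
      unfolding S_def using op[OF that]
      by (intro bounded_linear_compose[OF bounded_linear_re]
          bounded_linear_compose[OF _ bounded_linear_Cplx_real]) (simp add: bounded_op_def)
    show "S (s + t) f = S s (S t f)" if "0 \<le> s" "0 \<le> t" for s t f
    proof -
      have "T (s + t) (Cplx f 0) = T s (T t (Cplx f 0))"
        using C0 that by (simp add: C0_semigroup_def)
      then show ?thesis using that by (simp add: T_real)
    qed
    show "\<forall>\<^sub>F t in at_top. 0 \<le> S t f" if "0 \<le> f" for f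
    proof -
      have "0 \<le> Cplx f 0" using that cplx_pos_iff by blast
      then obtain t0 where "t0 \<ge> 0" "\<forall>t\<ge>t0. 0 \<le> T t (Cplx f 0)"
        using pos unfolding individually_eventually_positive_def by blast
      then show ?thesis
        unfolding eventually_at_top_linorder S_def less_eq_complexification_def by auto
    qed
    show "\<exists>K. compact K \<and> (\<lambda>t. S t f) ` {0..} \<subseteq> K" for f
    proof (intro exI conjI)
      let ?K = "closure ((\<lambda>t. T t (Cplx f 0)) ` {0..})"
      show "compact (re ` ?K)"
        using cpt by (intro compact_continuous_image linear_continuous_on bounded_linear_re)
          (simp add: relatively_compact_orbits_def)
      show "(\<lambda>t. S t f) ` {0..} \<subseteq> re ` ?K"
        unfolding S_def using closure_subset by fastforce
    qed
    show "\<exists>t\<ge>0. dense_ideal (S t f)" if "0 \<le> f" "f \<noteq> 0" for f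
    proof -
      have "0 \<le> Cplx f 0" "Cplx f 0 \<noteq> 0"
        using that cplx_pos_iff by (auto simp: zero_complexification_def)
      then obtain t where "t \<ge> 0" "quasi_interior (T t (Cplx f 0))" using qi by blast
      then show ?thesis by (auto simp: T_real quasi_interior_Cplx_iff)
    qed
  qed
  then show ?thesis using that T_eq by blast
qed

text \<open>Inequality of two truth values expresses that exactly one of the alternatives
  holds.\<close>

theorem proposition6p1:
  fixes T :: "real \<Rightarrow> 'a::banach_lattice complexification \<Rightarrow> 'a complexification"
  assumes "C0_semigroup T"
    and "\<forall>t\<ge>0. real_op (T t)"
    and "individually_eventually_positive T"
    and "\<forall>f. 0 \<le> f \<and> f \<noteq> 0 \<longrightarrow> (\<exists>t\<ge>0. quasi_interior (T t f))"
    and "relatively_compact_orbits T"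
  shows "(converges_strongly T (\<lambda>_. 0)) \<noteq>
     (\<exists>u \<phi>. quasi_interior u \<and> \<phi> \<in> dual_space \<and> strictly_positive \<phi> \<and>
        u \<in> op_kernel (generator T) \<and>
        \<phi> \<in> dual_op_kernel (dual_operator (generator T)) \<and>
        rank_one_projection (tensor_op u \<phi>) \<and>
        converges_strongly T (tensor_op u \<phi>))" (is "?zero \<noteq> ?rank_one")
proof -
  \<comment> \<open>If both held, uniqueness of limits would make the rank-one projection
    zero.\<close>
  have excl: "\<not> (?zero \<and> ?rank_one)"
  proof
    assume *: "?zero \<and> ?rank_one"
    then obtain u \<phi> where r1: "rank_one_projection (tensor_op u \<phi>)"
      and conv: "converges_strongly T (tensor_op u \<phi>)" by blast
    have "tensor_op u \<phi> f = 0" for f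
      using * conv tendsto_unique[of at_top "\<lambda>t. T t f"]
      by (auto simp: converges_strongly_def trivial_limit_at_top_linorder)
    then show False using r1 tensor_op_zero_not_rank_one by blast
  qed
  obtain S where "real_semigroup S" and T: "\<And>t z. 0 \<le> t \<Longrightarrow> T t z = Cplx (S t (re z)) (S t (im z))"
    using real_semigroup_real_part[OF assms] by blast
  interpret real_semigroup S by fact
  have conv: "((\<lambda>t. T t z) \<longlongrightarrow> Cplx (proj (re z)) (proj (im z))) at_top" for z
  proof (rule Lim_transform_eventually[OF tendsto_Cplx[OF tendsto_proj tendsto_proj]])
    show "\<forall>\<^sub>F t in at_top. Cplx (S t (re z)) (S t (im z)) = T t z"
      using eventually_ge_at_top[of 0] by eventually_elim (simp add: T)
  qed
  have "?zero \<or> ?rank_one"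
  proof (cases "\<forall>g. proj g = 0")
    case True
    then show ?thesis
      using conv by (simp add: converges_strongly_def zero_complexification_def)
  next
    case False
    then obtain g where "proj g \<noteq> 0" by blast
    then obtain u c where u: "0 \<le> u" "u \<noteq> 0" "dense_ideal u" "\<forall>t\<ge>0. S t u = u"
      and c: "bounded_linear c" "c u = (1::real)" "\<forall>f. proj f = c f *\<^sub>R u"
        "\<forall>t\<ge>0. \<forall>f. c (S t f) = c f" "\<forall>f. 0 \<le> f \<and> f \<noteq> 0 \<longrightarrow> 0 < c f"
      by (rule proj_rank_one)
    interpret c: bounded_linear c by (rule c(1))
    define U where "U = Cplx u 0"
    \<comment> \<open>The complex-linear extension of the real functional \<open>c\<close>.\<close>
    define \<phi> where "\<phi> z = of_real (c (re z)) + \<i> * of_real (c (im z))" for z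
    have lin_\<phi>: "bounded_linear \<phi>"
      unfolding \<phi>_def
      by (intro bounded_linear_add bounded_linear_const_mult bounded_linear_compose[OF bounded_linear_of_real]
          bounded_linear_compose[OF c(1)] bounded_linear_re bounded_linear_im)
    interpret \<phi>: bounded_linear \<phi> by (rule lin_\<phi>)
    have dual: "\<phi> \<in> dual_space"
      using lin_\<phi> by (auto simp: dual_space_def complex_eq_iff \<phi>_def cscale_def c.add c.diff c.scaleR)
    have inv: "\<phi> (T t z) = \<phi> z" if "0 \<le> t" for t z by (simp add: \<phi>_def T that c(4))
    have "quasi_interior U" using u by (simp add: U_def quasi_interior_Cplx_iff)
    moreover have "strictly_positive \<phi>"
      unfolding strictly_positive_def
    proof (intro allI impI)
      fix z :: "'a complexification" assume z: "0 \<le> z \<and> z \<noteq> 0"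
      then obtain x where x: "0 \<le> x" "z = Cplx x 0" unfolding cplx_pos_iff by blast
      then have "x \<noteq> 0" using z by (auto simp: zero_complexification_def)
      then have "0 < c x" using c(5) x(1) by blast
      then show "\<phi> z \<in> \<real> \<and> 0 < Re (\<phi> z)" by (simp add: \<phi>_def x(2) c.zero)
    qed
    moreover have "U \<in> op_kernel (generator T)"
    proof -
      have "T h U = U" if "0 \<le> h" for h
        using that linear_0[OF bounded_linear.linear[OF lin[OF that]]] by (simp add: T U_def u(4))
      then have "\<forall>\<^sub>F h in at_right 0. 0 = (T h U - U) /\<^sub>R h"
        by (intro eventually_mono[OF eventually_at_right_less]) simp
      then have "((\<lambda>h. (T h U - U) /\<^sub>R h) \<longlongrightarrow> 0) (at_right 0)"
        by (rule Lim_transform_eventually[OF tendsto_const])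
      then show ?thesis by (simp add: op_kernel_def generator_def)
    qed
    moreover have "\<phi> \<in> dual_op_kernel (dual_operator (generator T))"
    proof -
      \<comment> \<open>Invariance of \<open>\<phi>\<close> under \<open>T\<close> makes it vanish
        on every difference quotient, hence on the limit \<open>g\<close>.\<close>
      have "\<phi> g = 0" if "(f, g) \<in> generator T" for f g
      proof (rule tendsto_unique[OF trivial_limit_at_right_real])
        show "((\<lambda>h. \<phi> ((T h f - f) /\<^sub>R h)) \<longlongrightarrow> \<phi> g) (at_right 0)"
          using that by (intro \<phi>.tendsto) (simp add: generator_def)
        have "\<forall>\<^sub>F h in at_right 0. 0 = \<phi> ((T h f - f) /\<^sub>R h)"
          by (intro eventually_mono[OF eventually_at_right_less]) (simp add: \<phi>.scaleR \<phi>.diff inv)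
        then show "((\<lambda>h. \<phi> ((T h f - f) /\<^sub>R h)) \<longlongrightarrow> 0) (at_right 0)"
          by (rule Lim_transform_eventually[OF tendsto_const])
      qed
      then show ?thesis
        using dual by (auto simp: dual_op_kernel_def dual_operator_def dual_space_def bounded_linear_zero)
    qed
    moreover have "rank_one_projection (tensor_op U \<phi>)"
      by (rule rank_one_projection_tensor_op[OF dual]) (simp add: \<phi>_def U_def c.zero c(2))
    moreover have "converges_strongly T (tensor_op U \<phi>)"
    proof -
      have "tensor_op U \<phi> z = Cplx (proj (re z)) (proj (im z))" for z
        by (simp add: tensor_op_def U_def \<phi>_def cscale_def c(3))
      then show ?thesis using conv by (simp add: converges_strongly_def)
    qed
    ultimately show ?thesis using dual by blast
  qed
  then show ?thesis using excl by blast
qed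

end
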